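(* There is an algorithm which, for every vertex-weighted cactus $K$ with positive real vertex weights, having $n$ vertices and $b<n$ blocks, computes the weighted domination number $\gamma_w(K)$ using fewer than $12n+5b$ additions and fewer than $9n+2b$ $\min$-operations (binary minima of real numbers).
   Context: A graph $K$ is a cactus if it is connected and any two of its cycles have at most one vertex in common (equivalently, every edge lies on at most one cycle). Vertices of a cactus are classified as: $C$-vertices (on a cycle and of degree $2$), $G$-vertices (not on any cycle), and $H$-vertices or hinges (on at least one cycle and of degree $\ge 3$). A subtree of the cactus is a tree induced by a set of $G$-vertices and $H$-vertices only; a graft is a maximal such subtree. A block is either a cycle of $K$ or a graft; $b$ denotes the total number of blocks. A weighted graph $(G,w)$ has $w:V(G)\to\mathbb{R}_{+}$; for $D\subseteq V(G)$, $w(D)=\sum_{v\in D}w(v)$. $D$ is a dominating set if every vertex is in $D$ or adjacent to a vertex of $D$, and $\gamma_w(G)=\min\{w(D): D \text{ dominating set of } G\}$. Only additions and minimum operations on weight values are counted; the cactus is assumed to be given together with its depth-first-search data structure (DFS order, DFS father of each vertex, and for each cycle its first vertex in DFS order), whose construction is not counted. *)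

theory Defs
  imports Complex_Main "Graph_Theory.Digraph_Component" "Graph_Theory.Pair_Digraph"
begin

section \<open>Cacti\<close>

text \<open>
  A finite simple undirected graph is a \<^locale>\<open>pair_graph\<close>, i.e. a finite, loop-free, symmetric
  digraph. In such a digraph the library's directed \<open>cycle\<close> and \<open>tree\<close> are not the
  undirected notions, since \<open>a, b, a\<close> counts as a directed cycle. Undirected cycles are therefore
  defined here. A cycle is identified with its set of (undirected) edges, so that rotations and
  reversals of a vertex list denote the same cycle.
\<close>

definition cycle_list :: "'a pair_pre_digraph \<Rightarrow> 'a list \<Rightarrow> bool" where
  "cycle_list G c \<longleftrightarrow> 3 \<le> length c \<and> distinct c \<and>
     (\<forall>i<length c. (c ! i, c ! (Suc i mod length c)) \<in> parcs G)"

definition cycle_edges :: "'a list \<Rightarrow> 'a set set" where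
  "cycle_edges c = {{c ! i, c ! (Suc i mod length c)} | i. i < length c}"

definition cycles :: "'a pair_pre_digraph \<Rightarrow> 'a set set set" where
  "cycles G = cycle_edges ` {c. cycle_list G c}"

abbreviation cycle_verts :: "'a set set \<Rightarrow> 'a set" where
  "cycle_verts C \<equiv> \<Union>C"

definition cactus :: "'a pair_pre_digraph \<Rightarrow> bool" where
  "cactus G \<longleftrightarrow> pair_graph G \<and> connected (with_proj G) \<and>
     (\<forall>C\<in>cycles G. \<forall>C'\<in>cycles G. C \<noteq> C' \<longrightarrow> card (cycle_verts C \<inter> cycle_verts C') \<le> 1)"

definition on_cycle :: "'a pair_pre_digraph \<Rightarrow> 'a \<Rightarrow> bool" where
  "on_cycle G v \<longleftrightarrow> (\<exists>C\<in>cycles G. v \<in> cycle_verts C)"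

definition C_vertices :: "'a pair_pre_digraph \<Rightarrow> 'a set" where
  "C_vertices G = {v \<in> pverts G. on_cycle G v \<and> out_degree (with_proj G) v = 2}"

definition G_vertices :: "'a pair_pre_digraph \<Rightarrow> 'a set" where
  "G_vertices G = {v \<in> pverts G. \<not> on_cycle G v}"

definition H_vertices :: "'a pair_pre_digraph \<Rightarrow> 'a set" where
  "H_vertices G = {v \<in> pverts G. on_cycle G v \<and> out_degree (with_proj G) v \<ge> 3}"

definition pair_induce :: "'a pair_pre_digraph \<Rightarrow> 'a set \<Rightarrow> 'a pair_pre_digraph" where
  "pair_induce G S = \<lparr>pverts = S, parcs = {(u, v) \<in> parcs G. u \<in> S \<and> v \<in> S}\<rparr>"

lemma with_proj_pair_induce: "with_proj (pair_induce G S) = with_proj G \<restriction> S"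
  by (auto simp: pair_induce_def induce_subgraph_def with_proj_def)

definition undirected_tree :: "'a pair_pre_digraph \<Rightarrow> bool" where
  "undirected_tree T \<longleftrightarrow> connected (with_proj T) \<and> cycles T = {}"

text \<open>Subtrees and grafts are induced, hence represented by their vertex sets.\<close>

definition subtree :: "'a pair_pre_digraph \<Rightarrow> 'a set \<Rightarrow> bool" where
  "subtree G S \<longleftrightarrow> S \<subseteq> G_vertices G \<union> H_vertices G \<and> undirected_tree (pair_induce G S)"

definition graft :: "'a pair_pre_digraph \<Rightarrow> 'a set \<Rightarrow> bool" where
  "graft G S \<longleftrightarrow> subtree G S \<and> (\<forall>T. subtree G T \<and> S \<subseteq> T \<longrightarrow> T = S)"

definition num_blocks :: "'a pair_pre_digraph \<Rightarrow> nat" where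
  "num_blocks G = card (cycles G) + card {S. graft G S}"

section \<open>Weighted domination\<close>

definition dominating_set :: "'a pair_pre_digraph \<Rightarrow> 'a set \<Rightarrow> bool" where
  "dominating_set G D \<longleftrightarrow> D \<subseteq> pverts G \<and> (\<forall>v\<in>pverts G. v \<in> D \<or> (\<exists>u\<in>D. (u, v) \<in> parcs G))"

definition weighted_domination_number :: "'a pair_pre_digraph \<Rightarrow> ('a \<Rightarrow> real) \<Rightarrow> real" where
  "weighted_domination_number G w = Min ((\<lambda>D. sum w D) ` {D. dominating_set G D})"

section \<open>Depth-first-search data\<close>

text \<open>
  A list \<open>xs\<close> of the vertices is a DFS order with father function \<open>fa\<close> if every vertex after
  the first is a neighbour of the most recently visited vertex that still has an unvisited
  neighbour, and \<open>fa\<close> maps it to that vertex. By convention the first vertex is its own father.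
\<close>

definition dfs_order :: "'a pair_pre_digraph \<Rightarrow> 'a list \<Rightarrow> ('a \<Rightarrow> 'a) \<Rightarrow> bool" where
  "dfs_order G xs fa \<longleftrightarrow> distinct xs \<and> set xs = pverts G \<and> fa (hd xs) = hd xs \<and>
     (\<forall>i. 0 < i \<and> i < length xs \<longrightarrow>
       (\<exists>j<i. fa (xs ! i) = xs ! j \<and> (xs ! j, xs ! i) \<in> parcs G \<and>
         (\<forall>k. j < k \<and> k < i \<longrightarrow> (\<forall>u. (xs ! k, u) \<in> parcs G \<longrightarrow> u \<in> set (take i xs)))))"

definition first_in :: "'a list \<Rightarrow> 'a set \<Rightarrow> 'a" where
  "first_in xs S = hd (filter (\<lambda>v. v \<in> S) xs)"

text \<open>
  The first vertices of the cycles are stored per vertex: in a cactus every vertex is a non-first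
  vertex of at most one cycle. If there is such a cycle, the vertex stores the first
  vertex of that cycle; otherwise it stores itself.
\<close>

definition cycle_firsts :: "'a pair_pre_digraph \<Rightarrow> 'a list \<Rightarrow> ('a \<Rightarrow> 'a) \<Rightarrow> bool" where
  "cycle_firsts G xs cf \<longleftrightarrow>
     (\<forall>C\<in>cycles G. \<forall>v\<in>cycle_verts C.
        v \<noteq> first_in xs (cycle_verts C) \<longrightarrow> cf v = first_in xs (cycle_verts C)) \<and>
     (\<forall>v\<in>pverts G.
        (\<forall>C\<in>cycles G. v \<in> cycle_verts C \<longrightarrow> v = first_in xs (cycle_verts C)) \<longrightarrow> cf v = v)"

definition dfs_data ::
    "'a pair_pre_digraph \<Rightarrow> 'a list \<Rightarrow> ('a \<Rightarrow> 'a) \<Rightarrow> ('a \<Rightarrow> 'a) \<Rightarrow> bool" where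
  "dfs_data G xs fa cf \<longleftrightarrow> dfs_order G xs fa \<and> cycle_firsts G xs cf"

section \<open>Algorithms\<close>

text \<open>
  An algorithm is a single program of a while language working on two memories: one of natural
  numbers, with unrestricted arithmetic and control flow at no cost, and one of real numbers
  (weights), which can only be cleared, copied, added and minimised. Control flow cannot inspect
  weights, so comparing them is possible only through counted operations. Memory cells are
  addressed by a name and a list of indices, \<open>[]\<close> for scalars, \<open>[i]\<close> for arrays,
  \<open>[i, j]\<close> for matrices.
\<close>

type_synonym vname = string
type_synonym nat_memory = "vname \<Rightarrow> nat list \<Rightarrow> nat"
type_synonym weight_memory = "vname \<Rightarrow> nat list \<Rightarrow> real"
type_synonym state = "nat_memory \<times> weight_memory"

datatype aexp =
    Const nat
  | Cell vname "aexp list"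
  | Plus aexp aexp
  | Minus aexp aexp
  | Times aexp aexp
  | Div aexp aexp
  | Mod aexp aexp

fun aval :: "aexp \<Rightarrow> nat_memory \<Rightarrow> nat" where
  "aval (Const k) s = k"
| "aval (Cell x es) s = s x (map (\<lambda>e. aval e s) es)"
| "aval (Plus e f) s = aval e s + aval f s"
| "aval (Minus e f) s = aval e s - aval f s"
| "aval (Times e f) s = aval e s * aval f s"
| "aval (Div e f) s = aval e s div aval f s"
| "aval (Mod e f) s = aval e s mod aval f s"

datatype bexp =
    Less aexp aexp
  | Equal aexp aexp
  | Neg bexp
  | Conj bexp bexp

fun bval :: "bexp \<Rightarrow> nat_memory \<Rightarrow> bool" where
  "bval (Less e f) s \<longleftrightarrow> aval e s < aval f s"
| "bval (Equal e f) s \<longleftrightarrow> aval e s = aval f s"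
| "bval (Neg b) s \<longleftrightarrow> \<not> bval b s"
| "bval (Conj b c) s \<longleftrightarrow> bval b s \<and> bval c s"

datatype loc = Loc vname "aexp list"

fun addr :: "loc \<Rightarrow> nat_memory \<Rightarrow> vname \<times> nat list" where
  "addr (Loc x es) s = (x, map (\<lambda>e. aval e s) es)"

definition load :: "(vname \<Rightarrow> nat list \<Rightarrow> 'v) \<Rightarrow> vname \<times> nat list \<Rightarrow> 'v" where
  "load m a = m (fst a) (snd a)"

definition store ::
    "(vname \<Rightarrow> nat list \<Rightarrow> 'v) \<Rightarrow> vname \<times> nat list \<Rightarrow> 'v \<Rightarrow> vname \<Rightarrow> nat list \<Rightarrow> 'v" where
  "store m a v = m(fst a := (m (fst a))(snd a := v))"

datatype com =
    Skip
  | Assign loc aexp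
  | WZero loc
  | WCopy loc loc
  | WAdd loc loc loc
  | WMin loc loc loc
  | Seq com com
  | If bexp com com
  | While bexp com

text \<open>
  \<open>exec c \<sigma> p q \<tau>\<close>: started in \<open>\<sigma>\<close>, the program \<open>c\<close> terminates in \<open>\<tau>\<close> after performing
  exactly \<open>p\<close> additions and \<open>q\<close> binary minima of weights.
\<close>

inductive exec :: "com \<Rightarrow> state \<Rightarrow> nat \<Rightarrow> nat \<Rightarrow> state \<Rightarrow> bool" where
  Skip: "exec Skip \<sigma> 0 0 \<sigma>"
| Assign: "exec (Assign l e) (s, r) 0 0 (store s (addr l s) (aval e s), r)"
| WZero: "exec (WZero l) (s, r) 0 0 (s, store r (addr l s) 0)"
| WCopy: "exec (WCopy l l1) (s, r) 0 0 (s, store r (addr l s) (load r (addr l1 s)))"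
| WAdd: "exec (WAdd l l1 l2) (s, r) 1 0
           (s, store r (addr l s) (load r (addr l1 s) + load r (addr l2 s)))"
| WMin: "exec (WMin l l1 l2) (s, r) 0 1
           (s, store r (addr l s) (min (load r (addr l1 s)) (load r (addr l2 s))))"
| Seq: "exec c \<sigma> p q \<sigma>' \<Longrightarrow> exec d \<sigma>' p' q' \<tau> \<Longrightarrow> exec (Seq c d) \<sigma> (p + p') (q + q') \<tau>"
| IfTrue: "bval b (fst \<sigma>) \<Longrightarrow> exec c \<sigma> p q \<tau> \<Longrightarrow> exec (If b c d) \<sigma> p q \<tau>"
| IfFalse: "\<not> bval b (fst \<sigma>) \<Longrightarrow> exec d \<sigma> p q \<tau> \<Longrightarrow> exec (If b c d) \<sigma> p q \<tau>"
| WhileFalse: "\<not> bval b (fst \<sigma>) \<Longrightarrow> exec (While b c) \<sigma> 0 0 \<sigma>"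
| WhileTrue: "bval b (fst \<sigma>) \<Longrightarrow> exec c \<sigma> p q \<sigma>' \<Longrightarrow> exec (While b c) \<sigma>' p' q' \<tau> \<Longrightarrow>
           exec (While b c) \<sigma> (p + p') (q + q') \<tau>"

inductive_cases SkipE: "exec Skip \<sigma> p q \<tau>"
inductive_cases AssignE: "exec (Assign l e) \<sigma> p q \<tau>"
inductive_cases WZeroE: "exec (WZero l) \<sigma> p q \<tau>"
inductive_cases WCopyE: "exec (WCopy l l1) \<sigma> p q \<tau>"
inductive_cases WAddE: "exec (WAdd l l1 l2) \<sigma> p q \<tau>"
inductive_cases WMinE: "exec (WMin l l1 l2) \<sigma> p q \<tau>"
inductive_cases SeqE: "exec (Seq c d) \<sigma> p q \<tau>"
inductive_cases IfE: "exec (If b c d) \<sigma> p q \<tau>"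
inductive_cases WhileE: "exec (While b c) \<sigma> p q \<tau>"

lemma exec_deterministic:
  assumes "exec c \<sigma> p q \<tau>" and "exec c \<sigma> p' q' \<tau>'"
  shows "p' = p \<and> q' = q \<and> \<tau>' = \<tau>"
  using assms
proof (induction arbitrary: p' q' \<tau>' rule: exec.induct)
  case (Seq c \<sigma> p1 q1 \<sigma>1 d p2 q2 \<tau>)
  from Seq.prems show ?case
    by (rule SeqE) (use Seq.IH in blast)
next
  case (IfTrue b \<sigma> c p q \<tau> d)
  from IfTrue.prems show ?case
    by (rule IfE) (use IfTrue in blast)+
next
  case (IfFalse b \<sigma> d p q \<tau> c)
  from IfFalse.prems show ?case
    by (rule IfE) (use IfFalse in blast)+
next
  case (WhileTrue b \<sigma> c p1 q1 \<sigma>1 p2 q2 \<tau>)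
  from WhileTrue.prems show ?case
    by (rule WhileE) (use WhileTrue in blast)+
qed (auto elim: SkipE AssignE WZeroE WCopyE WAddE WMinE WhileE)

text \<open>
  The input consists of the number of vertices, the adjacency matrix, the DFS data and the weights.
  All other cells are initially zero. Apart from the DFS order, whose index is a
  position, all arrays are indexed by vertices.
\<close>

definition input_nats ::
    "nat pair_pre_digraph \<Rightarrow> nat list \<Rightarrow> (nat \<Rightarrow> nat) \<Rightarrow> (nat \<Rightarrow> nat) \<Rightarrow> nat_memory" where
  "input_nats G xs fa cf = (\<lambda>x is. case is of
       [] \<Rightarrow> if x = ''n'' then card (pverts G) else 0
     | [i] \<Rightarrow>
         if x = ''order'' \<and> i < length xs then xs ! i
         else if x = ''father'' \<and> i \<in> pverts G then fa i
         else if x = ''first'' \<and> i \<in> pverts G then cf i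
         else 0
     | [u, v] \<Rightarrow> if x = ''adj'' \<and> (u, v) \<in> parcs G then 1 else 0
     | _ \<Rightarrow> 0)"

definition input_weights :: "nat pair_pre_digraph \<Rightarrow> (nat \<Rightarrow> real) \<Rightarrow> weight_memory" where
  "input_weights G w = (\<lambda>x is. case is of
       [v] \<Rightarrow> if x = ''w'' \<and> v \<in> pverts G then w v else 0
     | _ \<Rightarrow> 0)"

definition input_state ::
    "nat pair_pre_digraph \<Rightarrow> (nat \<Rightarrow> real) \<Rightarrow> nat list \<Rightarrow> (nat \<Rightarrow> nat) \<Rightarrow> (nat \<Rightarrow> nat) \<Rightarrow> state" where
  "input_state G w xs fa cf = (input_nats G xs fa cf, input_weights G w)"

definition result :: "state \<Rightarrow> real" where
  "result \<sigma> = snd \<sigma> ''gamma'' []"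

end

theory Submission
  imports Defs
begin

text \<open>
  The vertices are treated in reverse depth-first-search order. In a cactus every tree edge lies on
  at most one fundamental cycle, so a cycle is a tree path closed by one back edge, and a vertex
  passes its subtree on either to its father for good (bridges and topmost vertices of cycles), or as
  a piece of a still open cycle. For a piece hanging at \<open>v\<close> three values suffice: the minimum weight
  when \<open>v\<close> is chosen, when everything is dominated, and when \<open>v\<close> need not be dominated; unlike for
  the usual three states all of them are finite, also for a single vertex. Gluing two pieces at an
  edge then costs four additions and three minima. On an open cycle these triples are kept for each
  of the three relations between the two ends of its back edge, so extending it costs at most
  \<open>3 * 4 = 12\<close> additions and \<open>3 * 3 = 9\<close> minima, while closing it (or a bridge, seen as a path with a
  single vertex) costs five and four. There are only \<open>n - 1\<close> such steps.
\<close>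

section \<open>Optimal values over families of sets\<close>

text \<open>A vertex may be forced into the set or excused from being dominated, but it is never
  forbidden. Hence \<open>fam\<close> grows with \<open>X\<close> and shrinks with \<open>F\<close>,
  it contains \<open>S\<close> itself whenever \<open>F\<close> lies in \<open>S\<close>, and
  overlapping cases are harmless under a minimum. The value with \<open>v\<close> forced can
  therefore be reused inside the other two entries of a triple without a new addition; this is where
  four additions and three minima come from.

  The obstacle is the topmost vertex of a cycle: it is adjacent to both ends of the path below it,
  so what it may need from the lower end must have been recorded on the way up. Three conditions at
  the lower end times three entries at the upper end give nine numbers, of which closing reads four.

  The cactus condition is used in the form that at most one back edge covers a tree edge. So at most
  one child of a vertex carries an open cycle, and two open cycles never have to be
  combined.\<close>

definition val :: "('a \<Rightarrow> real) \<Rightarrow> 'a set set \<Rightarrow> real" where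
  "val W \<F> = Min (sum W ` \<F>)"

definition join :: "'a set set \<Rightarrow> 'a set set \<Rightarrow> 'a set set" where
  "join \<F> \<G> = {A \<union> B | A B. A \<in> \<F> \<and> B \<in> \<G>}"

lemma val_Un:
  assumes "finite \<F>" "finite \<G>" "\<F> \<noteq> {}" "\<G> \<noteq> {}"
  shows "val W (\<F> \<union> \<G>) = min (val W \<F>) (val W \<G>)"
  using assms by (simp add: val_def image_Un Min_Un)

text \<open>On disjoint ground sets the two choices are independent and their weights add, so the
  minimum splits.\<close>

lemma val_join:
  assumes "finite S" "finite U" "S \<inter> U = {}" "\<F> \<subseteq> Pow S" "\<G> \<subseteq> Pow U" "\<F> \<noteq> {}" "\<G> \<noteq> {}"
  shows "val W (join \<F> \<G>) = val W \<F> + val W \<G>"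
proof -
  have fin: "finite \<F>" "finite \<G>"
    using assms by (meson finite_Pow_iff finite_subset)+
  have sum_eq: "sum W (A \<union> B) = sum W A + sum W B" if "A \<in> \<F>" "B \<in> \<G>" for A B
  proof (rule sum.union_disjoint)
    have "A \<subseteq> S" "B \<subseteq> U"
      using that assms by blast+
    then show "finite A" "finite B" "A \<inter> B = {}"
      using assms finite_subset by blast+
  qed
  have join_eq: "join \<F> \<G> = (\<lambda>(A, B). A \<union> B) ` (\<F> \<times> \<G>)"
    by (auto simp: join_def)
  have finj: "finite (join \<F> \<G>)"
    using fin by (simp add: join_eq)
  have "val W \<F> \<in> sum W ` \<F>" "val W \<G> \<in> sum W ` \<G>"
    unfolding val_def using fin assms by (auto intro!: Min_in)
  then obtain A B where AB: "A \<in> \<F>" "B \<in> \<G>" "val W \<F> = sum W A" "val W \<G> = sum W B"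
    by auto
  have low: "val W \<F> \<le> sum W A'" if "A' \<in> \<F>" for A'
    unfolding val_def using fin that by simp
  have low': "val W \<G> \<le> sum W B'" if "B' \<in> \<G>" for B'
    unfolding val_def using fin that by simp
  show ?thesis
    unfolding val_def[of W "join \<F> \<G>"]
  proof (rule Min_eqI)
    show "finite (sum W ` join \<F> \<G>)"
      using finj by simp
    show "val W \<F> + val W \<G> \<in> sum W ` join \<F> \<G>"
    proof (rule image_eqI)
      show "val W \<F> + val W \<G> = sum W (A \<union> B)"
        using AB sum_eq by simp
      show "A \<union> B \<in> join \<F> \<G>"
        using AB unfolding join_def by blast
    qed
    fix y assume "y \<in> sum W ` join \<F> \<G>"
    then obtain A' B' where "A' \<in> \<F>" "B' \<in> \<G>" "y = sum W (A' \<union> B')"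
      by (auto simp: join_def)
    then show "val W \<F> + val W \<G> \<le> y"
      using low low' by (simp add: sum_eq add_mono)
  qed
qed

definition dominated :: "('a \<Rightarrow> 'a \<Rightarrow> bool) \<Rightarrow> 'a set \<Rightarrow> 'a \<Rightarrow> bool" where
  "dominated E D x \<longleftrightarrow> x \<in> D \<or> (\<exists>y\<in>D. E y x)"

definition fam :: "('a \<Rightarrow> 'a \<Rightarrow> bool) \<Rightarrow> 'a set \<Rightarrow> 'a set \<Rightarrow> 'a set \<Rightarrow> 'a set set" where
  "fam E S F X = {D. F \<subseteq> D \<and> D \<subseteq> S \<and> (\<forall>x\<in>S - X. dominated E D x)}"

lemma fam_nonempty [simp]: "F \<subseteq> S \<Longrightarrow> fam E S F X \<noteq> {}"
  by (auto simp: fam_def dominated_def)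

lemma fam_subset_Pow: "fam E S F X \<subseteq> Pow S"
  by (auto simp: fam_def)

lemma finite_fam: "finite S \<Longrightarrow> finite (fam E S F X)"
  by (meson fam_subset_Pow finite_Pow_iff finite_subset)

text \<open>A chosen vertex dominates itself. This matters for a path of one vertex, where the
  conditions at both ends fall on the same vertex.\<close>

lemma fam_exempt_forced: "fam E S (insert v F) (insert v X) = fam E S (insert v F) X"
  by (auto simp: fam_def dominated_def)

lemma val_join_fam:
  assumes "finite S" "finite U" "S \<inter> U = {}" "F \<subseteq> S" "F' \<subseteq> U"
  shows "val W (join (fam E S F X) (fam E U F' X')) = val W (fam E S F X) + val W (fam E U F' X')"
  using assms by (intro val_join[of S U]) (auto simp: fam_nonempty dest: subsetD[OF fam_subset_Pow])

lemma finite_join_fam: "finite S \<Longrightarrow> finite U \<Longrightarrow> finite (join (fam E S F X) (fam E U F' X'))"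
proof -
  assume "finite S" "finite U"
  then have "finite (fam E S F X \<times> fam E U F' X')"
    by (simp add: finite_fam)
  moreover have "join (fam E S F X) (fam E U F' X') = (\<lambda>(A, B). A \<union> B) ` (fam E S F X \<times> fam E U F' X')"
    by (auto simp: join_def)
  ultimately show ?thesis
    by simp
qed

lemma join_fam_nonempty: "F \<subseteq> S \<Longrightarrow> F' \<subseteq> U \<Longrightarrow> join (fam E S F X) (fam E U F' X') \<noteq> {}"
  using fam_nonempty[of F S E X] fam_nonempty[of F' U E X'] unfolding join_def by blast

lemma in_join_iff:
  assumes "S \<inter> U = {}" "\<F> \<subseteq> Pow S" "\<G> \<subseteq> Pow U"
  shows "D \<in> join \<F> \<G> \<longleftrightarrow> D \<subseteq> S \<union> U \<and> D \<inter> S \<in> \<F> \<and> D \<inter> U \<in> \<G>"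
proof
  assume "D \<in> join \<F> \<G>"
  then obtain A B where "D = A \<union> B" "A \<in> \<F>" "B \<in> \<G>"
    by (auto simp: join_def)
  moreover from this have "D \<inter> S = A" "D \<inter> U = B"
    using assms by blast+
  ultimately show "D \<subseteq> S \<union> U \<and> D \<inter> S \<in> \<F> \<and> D \<inter> U \<in> \<G>"
    by auto
next
  assume "D \<subseteq> S \<union> U \<and> D \<inter> S \<in> \<F> \<and> D \<inter> U \<in> \<G>"
  moreover from this have "D = (D \<inter> S) \<union> (D \<inter> U)"
    by blast
  ultimately show "D \<in> join \<F> \<G>"
    unfolding join_def by blast
qed

section \<open>Gluing two parts along edges at one vertex\<close>

text \<open>
  \<open>N\<close> is a singleton for a tree edge and has two elements when a cycle is closed at \<open>v\<close>.
\<close>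

locale gluing =
  fixes E :: "'a \<Rightarrow> 'a \<Rightarrow> bool" and S U N F X :: "'a set" and v :: 'a
  assumes sym: "E x y \<Longrightarrow> E y x"
    and disj: "S \<inter> U = {}" and v: "v \<in> S" and N: "N \<subseteq> U" and F: "F \<subseteq> U" and X: "X \<subseteq> U"
    and edges: "s \<in> S \<Longrightarrow> t \<in> U \<Longrightarrow> E s t \<longleftrightarrow> s = v \<and> t \<in> N"
begin

lemma dominated_S: 
  assumes "D \<subseteq> S \<union> U" "x \<in> S"
  shows "dominated E D x \<longleftrightarrow> dominated E (D \<inter> S) x \<or> x = v \<and> D \<inter> N \<noteq> {}"
proof -
  have "E y x \<longleftrightarrow> x = v \<and> y \<in> N" if "y \<in> U" for y
    using sym edges[OF \<open>x \<in> S\<close> that] by blast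
  then show ?thesis
    using assms N disj v unfolding dominated_def by blast
qed

lemma dominated_U:
  assumes "D \<subseteq> S \<union> U" "x \<in> U"
  shows "dominated E D x \<longleftrightarrow> dominated E (D \<inter> U) x \<or> v \<in> D \<and> x \<in> N"
  using assms N disj v edges[OF _ \<open>x \<in> U\<close>] unfolding dominated_def by blast

lemmas in_join = in_join_iff[OF disj fam_subset_Pow fam_subset_Pow]

text \<open>With \<open>v\<close> chosen, all of \<open>N\<close> is dominated from across and
  becomes exempt in \<open>U\<close>, while \<open>S\<close> gains nothing, since \<open>v\<close>
  is the only vertex that \<open>U\<close> could help.\<close>

lemma fam_glue_forced:
  "fam E (S \<union> U) (insert v F) X = join (fam E S {v} {}) (fam E U F (X \<union> N))" (is "?L = ?R")
proof (rule set_eqI)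
  fix D
  show "D \<in> ?L \<longleftrightarrow> D \<in> ?R"
  proof (cases "D \<subseteq> S \<union> U \<and> v \<in> D")
    case True
    have "dominated E (D \<inter> S) v"
      using True v by (auto simp: dominated_def)
    then have "\<forall>x\<in>S. dominated E D x \<longleftrightarrow> dominated E (D \<inter> S) x"
      using dominated_S[of D] True by blast
    moreover have "\<forall>x\<in>U. dominated E D x \<longleftrightarrow> dominated E (D \<inter> U) x \<or> x \<in> N"
      using dominated_U[of D] True by blast
    moreover have "S \<union> U - X = S \<union> (U - X)"
      using X disj by blast
    ultimately have "(\<forall>x\<in>S \<union> U - X. dominated E D x) \<longleftrightarrow>
        (\<forall>x\<in>S. dominated E (D \<inter> S) x) \<and> (\<forall>x\<in>U - (X \<union> N). dominated E (D \<inter> U) x)"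
      by auto
    then show ?thesis
      unfolding in_join using True F v by (auto simp: fam_def)
  next
    case False
    then show ?thesis
      unfolding in_join by (auto simp: fam_def)
  qed
qed

lemma all_dominated_notin:
  assumes "D \<subseteq> S \<union> U" "v \<notin> D"
  shows "(\<forall>x\<in>S \<union> U - insert v X. dominated E D x) \<longleftrightarrow>
     (\<forall>x\<in>S - {v}. dominated E (D \<inter> S) x) \<and> (\<forall>x\<in>U - X. dominated E (D \<inter> U) x)"
proof -
  have "S \<union> U - insert v X = (S - {v}) \<union> (U - X)"
    using X v disj by blast
  moreover have "\<forall>x\<in>S - {v}. dominated E D x \<longleftrightarrow> dominated E (D \<inter> S) x"
    using dominated_S[of D] assms(1) by blast
  moreover have "\<forall>x\<in>U. dominated E D x \<longleftrightarrow> dominated E (D \<inter> U) x"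
    using dominated_U[of D] assms by blast
  ultimately show ?thesis
    by (auto simp: ball_Un)
qed

text \<open>Either \<open>v\<close> is chosen, or no domination across the cut matters: nothing in
  \<open>U\<close> is helped by \<open>v\<close>, and \<open>v\<close> itself is excused.\<close>

lemma fam_glue_exempt:
  "fam E (S \<union> U) F (insert v X) =
     fam E (S \<union> U) (insert v F) X \<union> join (fam E S {} {v}) (fam E U F X)" (is "?L = ?R")
proof (rule set_eqI)
  fix D
  show "D \<in> ?L \<longleftrightarrow> D \<in> ?R"
  proof (cases "v \<in> D")
    case True
    then have "D \<in> fam E (S \<union> U) (insert v F) X \<longleftrightarrow> D \<in> ?L"
      by (auto simp: fam_def dominated_def)
    moreover have "D \<in> ?L" if "D \<in> join (fam E S {} {v}) (fam E U F X)"
      using that dominated_S[of D] dominated_U[of D] unfolding in_join by (auto simp: fam_def)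
    ultimately show ?thesis
      by blast
  next
    case False
    then show ?thesis
      unfolding Un_iff in_join using all_dominated_notin[of D] F by (auto simp: fam_def)
  qed
qed

text \<open>If \<open>v\<close> is not chosen, its dominator lies in \<open>S\<close> or is some
  \<open>z\<close> in \<open>N\<close>, which may then be forced. The cases overlap.\<close>

lemma fam_glue:
  "fam E (S \<union> U) F X =
     fam E (S \<union> U) (insert v F) X \<union> join (fam E S {} {}) (fam E U F X) \<union>
     (\<Union>z\<in>N. join (fam E S {} {v}) (fam E U (insert z F) X))" (is "?L = ?R")
proof (rule set_eqI)
  fix D
  \<comment> \<open>Domination inside one side persists in the union, so \<open>v\<close> is the
    only vertex left to check for the last two kinds of families.\<close>
  have star: "D \<in> ?L" if "D \<subseteq> S \<union> U" "F \<subseteq> D" "\<forall>x\<in>U - X. dominated E (D \<inter> U) x"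
    "\<forall>x\<in>S - {v}. dominated E (D \<inter> S) x" "dominated E D v"
    using that dominated_S[of D] dominated_U[of D] v unfolding fam_def by auto
  show "D \<in> ?L \<longleftrightarrow> D \<in> ?R"
  proof
    assume L: "D \<in> ?L"
    then have D: "D \<subseteq> S \<union> U" "F \<subseteq> D" "\<And>x. x \<in> S \<union> U - X \<Longrightarrow> dominated E D x"
      by (auto simp: fam_def)
    have vX: "v \<notin> X"
      using v X disj by blast
    show "D \<in> ?R"
    proof (cases "v \<in> D")
      case True
      then show ?thesis using L by (auto simp: fam_def)
    next
      case False
      then have U: "\<forall>x\<in>U - X. dominated E (D \<inter> U) x" and S: "\<forall>x\<in>S - {v}. dominated E (D \<inter> S) x"
        using all_dominated_notin[of D] D by auto
      show ?thesis
      proof (cases "D \<inter> N = {}")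
        case True
        then have "dominated E (D \<inter> S) v"
          using D(3)[of v] dominated_S[OF D(1) v] v vX by blast
        then have "D \<in> join (fam E S {} {}) (fam E U F X)"
          unfolding in_join using D U S F by (auto simp: fam_def)
        then show ?thesis by blast
      next
        case False
        then obtain z where "z \<in> D" "z \<in> N" by blast
        then have "D \<in> join (fam E S {} {v}) (fam E U (insert z F) X)"
          unfolding in_join using D U S F N by (auto simp: fam_def)
        then show ?thesis using \<open>z \<in> N\<close> by blast
      qed
    qed
  next
    assume "D \<in> ?R"
    then consider "D \<in> fam E (S \<union> U) (insert v F) X" | "D \<in> join (fam E S {} {}) (fam E U F X)"
      | z where "z \<in> N" "D \<in> join (fam E S {} {v}) (fam E U (insert z F) X)"
      by blast
    then show "D \<in> ?L"
    proof cases
      case 1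
      then show ?thesis by (auto simp: fam_def)
    next
      case 2
      then have "D \<subseteq> S \<union> U" "F \<subseteq> D" "\<forall>x\<in>U - X. dominated E (D \<inter> U) x" "\<forall>x\<in>S. dominated E (D \<inter> S) x"
        unfolding in_join by (auto simp: fam_def)
      then show ?thesis
        using star dominated_S[of D v] v by blast
    next
      case 3
      then have "D \<subseteq> S \<union> U" "F \<subseteq> D" "\<forall>x\<in>U - X. dominated E (D \<inter> U) x"
        "\<forall>x\<in>S - {v}. dominated E (D \<inter> S) x" "z \<in> D"
        unfolding in_join by (auto simp: fam_def)
      then show ?thesis
        using star dominated_S[of D v] v \<open>z \<in> N\<close> by blast
    qed
  qed
qed

lemma val_glue_forced:
  assumes "finite S" "finite U"
  shows "val W (fam E (S \<union> U) (insert v F) X) = val W (fam E S {v} {}) + val W (fam E U F (X \<union> N))"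
  unfolding fam_glue_forced using assms disj v F by (intro val_join_fam) auto

lemma val_glue_exempt:
  assumes "finite S" "finite U"
  shows "val W (fam E (S \<union> U) F (insert v X)) =
    min (val W (fam E (S \<union> U) (insert v F) X)) (val W (fam E S {} {v}) + val W (fam E U F X))"
proof -
  have "insert v F \<subseteq> S \<union> U"
    using v F by blast
  then have "val W (fam E (S \<union> U) F (insert v X)) =
      min (val W (fam E (S \<union> U) (insert v F) X)) (val W (join (fam E S {} {v}) (fam E U F X)))"
    unfolding fam_glue_exempt using assms v F
    by (intro val_Un) (auto simp: finite_fam finite_join_fam join_fam_nonempty)
  then show ?thesis
    using val_join_fam[OF assms disj, of "{}" F] F by simp
qed

text \<open>Since \<open>x = y\<close> is allowed, the formula also serves a single connecting edge;
  its last term is then a repetition.\<close>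

lemma val_glue:
  assumes "finite S" "finite U" and xy: "N = {x, y}"
  shows "val W (fam E (S \<union> U) F X) =
    min (min (min (val W (fam E (S \<union> U) (insert v F) X))
        (val W (fam E S {} {}) + val W (fam E U F X)))
        (val W (fam E S {} {v}) + val W (fam E U (insert x F) X)))
        (val W (fam E S {} {v}) + val W (fam E U (insert y F) X))"
proof -
  have N': "x \<in> U" "y \<in> U" and vF: "insert v F \<subseteq> S \<union> U"
    using N xy v F by auto
  have "fam E (S \<union> U) F X =
     fam E (S \<union> U) (insert v F) X \<union> join (fam E S {} {}) (fam E U F X) \<union>
       join (fam E S {} {v}) (fam E U (insert x F) X) \<union> join (fam E S {} {v}) (fam E U (insert y F) X)"
    using fam_glue xy by auto
  also have "val W \<dots> =
    min (min (min (val W (fam E (S \<union> U) (insert v F) X))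
        (val W (join (fam E S {} {}) (fam E U F X))))
        (val W (join (fam E S {} {v}) (fam E U (insert x F) X))))
        (val W (join (fam E S {} {v}) (fam E U (insert y F) X)))"
    using assms F N' vF by (simp add: val_Un finite_fam finite_join_fam join_fam_nonempty)
  finally show ?thesis
    using val_join_fam[OF assms(1,2) disj] F N' by simp
qed

end

section \<open>Depth-first-search trees of cacti\<close>

text \<open>The guard \<open>0 < x\<close> ends the chain at position 0, the root, where
  \<open>par\<close> carries no information.\<close>

inductive anc :: "(nat \<Rightarrow> nat) \<Rightarrow> nat \<Rightarrow> nat \<Rightarrow> bool" for par where
  anc_refl: "anc par x x"
| anc_step: "0 < x \<Longrightarrow> anc par a (par x) \<Longrightarrow> anc par a x"

text \<open>The back edge from \<open>x\<close> to \<open>r\<close> closes a cycle through the tree edge from \<open>v\<close> to \<open>par v\<close>.\<close>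

definition covers :: "(nat \<Rightarrow> nat) \<Rightarrow> (nat \<Rightarrow> nat \<Rightarrow> bool) \<Rightarrow> nat \<Rightarrow> nat \<Rightarrow> nat \<Rightarrow> bool" where
  "covers par E v x r \<longleftrightarrow> anc par v x \<and> r < v \<and> E r x \<and> r \<noteq> par x"

text \<open>Vertices are their positions in the search order, so being visited earlier is
  \<open><\<close>. The depth-first rule is \<open>exhausted\<close>: a position strictly between
  \<open>par i\<close> and \<open>i\<close> had no unvisited neighbour left when \<open>i\<close>
  was reached.\<close>

locale dfs_tree =
  fixes n :: nat and par :: "nat \<Rightarrow> nat" and E :: "nat \<Rightarrow> nat \<Rightarrow> bool"
  assumes n_pos: "0 < n"
    and sym: "E i j \<Longrightarrow> E j i"
    and bounded: "E i j \<Longrightarrow> i < n"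
    and irrefl: "\<not> E i i"
    and par_less: "0 < i \<Longrightarrow> i < n \<Longrightarrow> par i < i"
    and par_edge: "0 < i \<Longrightarrow> i < n \<Longrightarrow> E (par i) i"
    and exhausted: "i < n \<Longrightarrow> par i < k \<Longrightarrow> k < i \<Longrightarrow> E k u \<Longrightarrow> u < i"
begin

abbreviation A where "A \<equiv> anc par"
abbreviation cov where "cov \<equiv> covers par E"

lemma anc_le: "A a x \<Longrightarrow> x < n \<Longrightarrow> a \<le> x"
proof (induction rule: anc.induct)
  case (anc_step x a)
  then show ?case
    using par_less[of x] by simp
qed simp

lemma anc_trans: "A b c \<Longrightarrow> A a b \<Longrightarrow> A a c"
  by (induction rule: anc.induct) (auto intro: anc.intros)

lemma anc_par: "A a x \<Longrightarrow> a \<noteq> x \<Longrightarrow> A a (par x)"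
  by (cases rule: anc.cases) auto

lemma anc_chain: "A b x \<Longrightarrow> A a x \<Longrightarrow> x < n \<Longrightarrow> a \<le> b \<Longrightarrow> A a b"
proof (induction rule: anc.induct)
  case (anc_step x b)
  show ?case
  proof (cases "a = x")
    case True
    then have "b = x"
      using anc_step anc_le[of b "par x"] par_less[of x] by simp
    then show ?thesis
      using True by (simp add: anc_refl)
  next
    case False
    then show ?thesis
      using anc_step anc_par[of a x] par_less[of x] by simp
  qed
qed

lemma anc_zero: "x < n \<Longrightarrow> A 0 x"
proof (induction x rule: less_induct)
  case (less x)
  then show ?case
    using par_less[of x] by (cases "x = 0") (auto intro: anc.intros)
qed

text \<open>If \<open>par m < j\<close>, then \<open>j\<close> was exhausted when \<open>m\<close>
  was visited, although its neighbour \<open>i\<close> comes no earlier than \<open>m\<close>. Hence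
  \<open>j \<le> par m\<close>, and the induction climbs. For \<open>m = i\<close> this excludes
  cross edges.\<close>

lemma edge_anc: "E j i \<Longrightarrow> j \<le> m \<Longrightarrow> m \<le> i \<Longrightarrow> A j m"
proof (induction m rule: less_induct)
  case (less m)
  show ?case
  proof (cases "j = m")
    case True
    then show ?thesis by (simp add: anc_refl)
  next
    case False
    have "i < n"
      using less.prems(1) sym bounded by blast
    then have m: "0 < m" "m < n"
      using less.prems False by auto
    have "j \<le> par m"
    proof (rule ccontr)
      assume "\<not> j \<le> par m"
      then have "i < m"
        using exhausted[OF m(2), of j i] less.prems False by simp
      then show False
        using less.prems by simp
    qed
    then have "A j (par m)"
      using less par_less[OF m] by simp
    then show ?thesis
      using m by (simp add: anc_step)
  qed
qed

lemma child_exists: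
  "A v x \<Longrightarrow> v \<noteq> x \<Longrightarrow> x < n \<Longrightarrow> \<exists>y. A y x \<and> 0 < y \<and> y \<le> x \<and> par y = v"
proof (induction rule: anc.induct)
  case (anc_step x v)
  have px: "par x < x"
    using anc_step.hyps anc_step.prems par_less by blast
  show ?case
  proof (cases "v = par x")
    case True
    then show ?thesis
      using anc_step by (intro exI[of _ x]) (simp add: anc_refl)
  next
    case False
    then obtain y where "A y (par x)" "0 < y" "y \<le> par x" "par y = v"
      using anc_step px by auto
    then show ?thesis
      using anc_step px by (intro exI[of _ y]) (auto intro: anc.intros)
  qed
qed simp

text \<open>Subtrees of siblings are disjoint: the smaller of two siblings above \<open>x\<close>
  would be an ancestor of the larger one, hence of their common father, which precedes both.\<close>

lemma siblings_eq:
  assumes "A y x" "A y' x" "x < n" "0 < y" "0 < y'" "par y = par y'"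
  shows "y = y'"
proof -
  have False if "A y x" "A y' x" "0 < y" "y < y'" "par y = par y'" for y y'
  proof -
    have "y' < n" "y < n"
      using anc_le[OF that(2)] assms(3) \<open>y < y'\<close> by simp_all
    have "A y y'"
      using anc_chain[OF that(2,1) assms(3)] that(4) by simp
    then have "A y (par y)"
      using anc_par[of y y'] that(4,5) by simp
    moreover have "par y < y"
      using par_less \<open>0 < y\<close> \<open>y < n\<close> by simp
    ultimately show False
      using anc_le[of y "par y"] \<open>y < n\<close> by simp
  qed
  from this[of y y'] this[of y' y] show ?thesis
    using assms by (cases y y' rule: linorder_cases) auto
qed

definition desc where "desc v = {x. x < n \<and> A v x}"

lemma finite_desc [simp]: "finite (desc v)"
  by (simp add: desc_def)

lemma desc_self: "v < n \<Longrightarrow> v \<in> desc v"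
  by (simp add: desc_def anc_refl)

lemma desc_zero: "desc 0 = {..<n}"
  using anc_zero by (auto simp: desc_def)

lemma coversD:
  assumes "cov v x r" "v < n"
  shows "A v x" "x < n" "r < v" "E r x" "r \<noteq> par x" "A r v" "A r (par v)" "r \<le> par v" "v \<le> x"
proof -
  from assms show 1: "A v x" "r < v" "E r x" "r \<noteq> par x"
    by (auto simp: covers_def)
  then show 2: "x < n"
    using sym bounded by blast
  show 3: "v \<le> x"
    using anc_le 1 2 by blast
  then show "A r v"
    using edge_anc[of r x v] 1 by simp
  then show 4: "A r (par v)"
    using anc_par 1 by blast
  have "par v < v"
    using par_less assms 1 by simp
  then show "r \<le> par v"
    using anc_le[OF 4] assms by simp
qed

end

section \<open>Open and closed cycles in the search tree\<close>

locale dfs_cactus = dfs_tree +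
  fixes cf :: "nat \<Rightarrow> nat"
  assumes covers_unique: "v < n \<Longrightarrow> cov v x r \<Longrightarrow> cov v x' r' \<Longrightarrow> x' = x \<and> r' = r"
    and first_covers: "v < n \<Longrightarrow> cov v x r \<Longrightarrow> cf v = r"
    and first_less: "v < n \<Longrightarrow> E (cf v) v \<Longrightarrow> cf v < v"
begin

text \<open>The cycle through the tree edge from \<open>y\<close> to \<open>par y\<close> extends beyond \<open>par y\<close>.\<close>

definition pend where "pend y \<longleftrightarrow> 0 < y \<and> (\<exists>x r. cov y x r \<and> r \<noteq> par y)"

text \<open>The default \<open>v\<close> makes a bridge a path whose two ends coincide, so bridges
  and cycles share one closing formula.\<close>

definition tip where "tip v = (if \<exists>x r. cov v x r then THE x. \<exists>r. cov v x r else v)"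

lemma tip_eq: "v < n \<Longrightarrow> cov v x r \<Longrightarrow> tip v = x"
  unfolding tip_def using covers_unique by (auto intro!: the_equality)

lemma tip_in_desc: "v < n \<Longrightarrow> tip v \<in> desc v"
proof (cases "\<exists>x r. cov v x r")
  case True
  assume "v < n"
  with True show ?thesis
    using tip_eq coversD(1,2) by (auto simp: desc_def)
qed (simp add: tip_def desc_self)

lemma pend_covers_par:
  assumes "y < n" "cov y x r" "r \<noteq> par y"
  shows "cov (par y) x r"
proof -
  have "0 < y" using coversD(3)[OF assms(2,1)] by simp
  then have "A (par y) y"
    by (rule anc_step[OF _ anc_refl])
  then have "A (par y) x"
    using coversD(1)[OF assms(2,1)] anc_trans by blast
  then show ?thesis
    using coversD[OF assms(2,1)] assms by (simp add: covers_def)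
qed

text \<open>Both open cycles would go on through the tree edge above the common father, which only
  one back edge covers. The lower end of that back edge would then lie below both siblings.\<close>

lemma pend_unique:
  assumes "y < n" "y' < n" "pend y" "pend y'" "par y = par y'"
  shows "y = y'"
proof -
  obtain x r x' r' where c: "cov y x r" "r \<noteq> par y" "cov y' x' r'" "r' \<noteq> par y'" "0 < y" "0 < y'"
    using assms by (auto simp: pend_def)
  have "par y < n"
    using par_less[of y] c assms by simp
  then have "x' = x"
    using covers_unique[of "par y" x r x' r'] pend_covers_par[of y x r] pend_covers_par[of y' x' r']
      assms c by simp
  then show ?thesis
    using siblings_eq coversD[OF c(1)] coversD[OF c(3)] assms c by blast
qed

text \<open>The part hanging at \<open>v\<close> when the positions from \<open>i\<close> on have been processed.\<close>

definition part where
  "part i v = insert v (\<Union>y\<in>{y. i \<le> y \<and> y < n \<and> 0 < y \<and> par y = v \<and> \<not> pend y}. desc y)"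

lemma finite_part [simp]: "finite (part i v)"
  by (simp add: part_def)

lemma self_in_part: "v \<in> part i v"
  by (simp add: part_def)

lemma part_n: "part n v = {v}"
  by (auto simp: part_def)

lemma part_step_other:
  assumes "v \<noteq> par i \<or> pend i"
  shows "part i v = part (Suc i) v"
proof -
  have "{y. i \<le> y \<and> y < n \<and> 0 < y \<and> par y = v \<and> \<not> pend y} =
      {y. Suc i \<le> y \<and> y < n \<and> 0 < y \<and> par y = v \<and> \<not> pend y}"
  proof (rule Collect_cong)
    fix y
    have "i \<le> y \<longleftrightarrow> y = i \<or> Suc i \<le> y"
      by auto
    then show "i \<le> y \<and> y < n \<and> 0 < y \<and> par y = v \<and> \<not> pend y \<longleftrightarrow>
        Suc i \<le> y \<and> y < n \<and> 0 < y \<and> par y = v \<and> \<not> pend y"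
      using assms by blast
  qed
  then show ?thesis
    unfolding part_def by argo
qed

lemma part_step_par:
  assumes "0 < i" "i < n" "\<not> pend i"
  shows "part i (par i) = part (Suc i) (par i) \<union> desc i"
proof -
  have "{y. i \<le> y \<and> y < n \<and> 0 < y \<and> par y = par i \<and> \<not> pend y} =
      insert i {y. Suc i \<le> y \<and> y < n \<and> 0 < y \<and> par y = par i \<and> \<not> pend y}"
    using assms by auto
  then show ?thesis
    by (auto simp: part_def)
qed

lemma desc_step: "0 < y \<Longrightarrow> desc y \<subseteq> desc (par y)"
  using anc_trans[of y _ "par y"] anc_step[OF _ anc_refl, of y] by (auto simp: desc_def)

text \<open>Children come after \<open>v\<close>, so the part at \<open>Suc v\<close> already
  contains every closed child; only a pending child is missing.\<close>

lemma desc_parts: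
  assumes "v < n"
  shows "desc v = part (Suc v) v \<union> (\<Union>y\<in>{y. y < n \<and> 0 < y \<and> par y = v \<and> pend y}. desc y)"
    (is "_ = ?R")
proof
  show "desc v \<subseteq> ?R"
  proof
    fix x assume "x \<in> desc v"
    show "x \<in> ?R"
    proof (cases "x = v")
      case True
      then show ?thesis by (simp add: self_in_part)
    next
      case False
      then obtain y where y: "A y x" "0 < y" "y \<le> x" "par y = v"
        using child_exists[of v x] \<open>x \<in> desc v\<close> by (auto simp: desc_def)
      then have "y < n" "x \<in> desc y"
        using \<open>x \<in> desc v\<close> by (auto simp: desc_def)
      moreover from this y have "Suc v \<le> y"
        using par_less[of y] by auto
      ultimately show ?thesis
        using y unfolding part_def by blast
    qed
  qed
  show "?R \<subseteq> desc v"
  proof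
    fix x assume "x \<in> ?R"
    then consider "x = v" | y where "0 < y" "par y = v" "x \<in> desc y"
      unfolding part_def by blast
    then show "x \<in> desc v"
      using desc_self[OF assms] desc_step by cases blast+
  qed
qed

lemma tip_child:
  assumes "v < n" "y < n" "par y = v" "pend y"
  shows "tip v = tip y" "\<exists>x r. cov v x r \<and> x \<noteq> v"
proof -
  obtain x r where c: "cov y x r" "r \<noteq> par y" "0 < y"
    using assms by (auto simp: pend_def)
  then have "cov v x r"
    using pend_covers_par assms by blast
  moreover have "v < y" "y \<le> x"
    using par_less[of y] coversD[OF c(1)] assms c by auto
  ultimately show "\<exists>x r. cov v x r \<and> x \<noteq> v"
    by fastforce
  show "tip v = tip y"
    using tip_eq[OF assms(1) \<open>cov v x r\<close>] tip_eq[OF assms(2) c(1)] by simp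
qed

lemma covers_below:
  assumes "v < n" "cov v x r" "x \<noteq> v"
  shows "\<exists>y. y < n \<and> v < y \<and> par y = v \<and> pend y"
proof -
  note c = coversD[OF assms(2,1)]
  obtain y where y: "A y x" "0 < y" "y \<le> x" "par y = v"
    using child_exists[of v x] c assms by auto
  then have "v < y" "y < n"
    using par_less[of y] c by auto
  then have "cov y x r"
    using c y by (simp add: covers_def)
  then show ?thesis
    using y c \<open>v < y\<close> \<open>y < n\<close> unfolding pend_def by blast
qed

lemma tip_childless:
  assumes "v < n" "\<nexists>y. y < n \<and> v < y \<and> par y = v \<and> pend y"
  shows "tip v = v"
proof (cases "\<exists>x r. cov v x r")
  case True
  then obtain x r where "cov v x r" by blast
  then have "x = v" "tip v = x"
    using covers_below[OF assms(1)] tip_eq[OF assms(1)] assms(2) by blast+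
  then show ?thesis by simp
qed (simp add: tip_def)

text \<open>This is the test that a program can evaluate. An open cycle reaches \<open>v\<close>
  through a pending child or starts at \<open>v\<close> with its back edge, and it stays open unless
  its first vertex is the father. In the converse direction \<open>first_less\<close> makes an edge
  to \<open>cf v\<close> a back edge leading upwards.\<close>

lemma pend_iff:
  assumes "0 < v" "v < n"
  shows "pend v \<longleftrightarrow> cf v \<noteq> par v \<and> ((\<exists>y. y < n \<and> v < y \<and> par y = v \<and> pend y) \<or> E v (cf v))"
proof
  assume "pend v"
  then obtain x r where c: "cov v x r" "r \<noteq> par v"
    by (auto simp: pend_def)
  then have "cf v = r"
    using first_covers assms by blast
  moreover have "E v r" if "x = v"
    using coversD[OF c(1) assms(2)] that sym by blast
  ultimately show "cf v \<noteq> par v \<and> ((\<exists>y. y < n \<and> v < y \<and> par y = v \<and> pend y) \<or> E v (cf v))"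
    using c covers_below[OF assms(2) c(1)] by blast
next
  assume R: "cf v \<noteq> par v \<and> ((\<exists>y. y < n \<and> v < y \<and> par y = v \<and> pend y) \<or> E v (cf v))"
  then consider y where "y < n" "par y = v" "pend y" | "E v (cf v)"
    by blast
  then have "\<exists>x r. cov v x r"
  proof cases
    case 1
    then show ?thesis using tip_child assms by blast
  next
    case 2
    then have "cov v v (cf v)"
      using R sym first_less[OF assms(2)] by (auto simp: covers_def anc_refl)
    then show ?thesis by blast
  qed
  then show "pend v"
    using R first_covers assms unfolding pend_def by blast
qed

text \<open>Depth-first search leaves no edge between the subtrees of siblings.\<close>

lemma part_edge:
  assumes y: "0 < y" "y < n" and s: "s \<in> part (Suc y) (par y) \<or> pend y \<and> s \<in> part i (par y)"
    and t: "t \<in> desc y" and "E s t"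
  shows "s = par y"
proof (rule ccontr)
  assume "s \<noteq> par y"
  \<comment> \<open>Either alternative for \<open>s\<close> keeps the subtree of \<open>y\<close>
    out of the part, hence \<open>z \<noteq> y\<close>.\<close>
  then obtain z where z: "z < n" "0 < z" "z \<noteq> y" "par z = par y" "s \<in> desc z"
    using s by (auto simp: part_def)
  show False
  proof (cases "s \<le> t")
    case True
    then have "A s t"
      using edge_anc \<open>E s t\<close> by blast
    then have "A z t"
      using z anc_trans by (auto simp: desc_def)
    then show False
      using siblings_eq[of y t z] t y z by (auto simp: desc_def)
  next
    case False
    then have "A t s"
      using edge_anc sym[OF \<open>E s t\<close>] by simp
    then have "A y s"
      using t anc_trans by (auto simp: desc_def)
    then show False
      using siblings_eq[of y s z] y z by (auto simp: desc_def)
  qed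
qed

lemma part_disjoint:
  assumes y: "0 < y" "y < n" and s: "s \<in> part (Suc y) (par y) \<or> pend y \<and> s \<in> part i (par y)"
  shows "s \<notin> desc y"
proof
  assume "s \<in> desc y"
  then have "y \<le> s"
    using anc_le by (auto simp: desc_def)
  then have "s \<noteq> par y"
    using par_less[OF y] by linarith
  then obtain z where "z < n" "0 < z" "z \<noteq> y" "par z = par y" "s \<in> desc z"
    using s by (auto simp: part_def)
  then show False
    using siblings_eq[of y s z] \<open>s \<in> desc y\<close> y by (auto simp: desc_def)
qed

text \<open>Besides the tree edge only a back edge ending at \<open>par y\<close> can occur. It
  exists exactly when a cycle closes there, and its lower end is \<open>tip y\<close>; for a bridge
  the set collapses to \<open>{y}\<close>.\<close>

lemma edge_par_desc:
  assumes y: "0 < y" "y < n" and t: "t \<in> desc y"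
  shows "E (par y) t \<longleftrightarrow> t \<in> (if pend y then {y} else {y, tip y})"
proof -
  have py: "par y < y"
    using par_less y by blast
  \<comment> \<open>A proper descendant of \<open>y\<close> has a father other than
    \<open>par y\<close>, so an edge from it to \<open>par y\<close> is a back edge covering
    \<open>y\<close>.\<close>
  have *: "E (par y) t \<longleftrightarrow> t = y \<or> cov y t (par y)"
  proof (cases "t = y")
    case True
    then show ?thesis using par_edge y by simp
  next
    case False
    have "par t \<noteq> par y"
    proof
      assume "par t = par y"
      then have "A y (par y)"
        using anc_par[of y t] t False by (auto simp: desc_def)
      then show False
        using anc_le[of y "par y"] py y by simp
    qed
    then show ?thesis
      using False t py by (auto simp: covers_def desc_def)
  qed
  show ?thesis
  proof (cases "pend y")
    case True
    then show ?thesis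
      using * covers_unique[OF y(2)] by (auto simp: pend_def)
  next
    case False
    show ?thesis
    proof (cases "\<exists>x r. cov y x r")
      case True
      then obtain x r where c: "cov y x r" by blast
      then have "r = par y"
        using \<open>\<not> pend y\<close> y by (auto simp: pend_def)
      then have "cov y t (par y) \<longleftrightarrow> t = x"
        using c covers_unique[OF y(2) c] by blast
      then show ?thesis
        using * \<open>\<not> pend y\<close> tip_eq[OF y(2) c] by simp
    next
      case no: False
      then show ?thesis
        using * \<open>\<not> pend y\<close> by (simp add: tip_def)
    qed
  qed
qed

lemma gluing_pend:
  assumes y: "y < n" "pend y" and FX: "F \<subseteq> desc y" "X \<subseteq> desc y"
  shows "gluing E (part i (par y)) (desc y) {y} F X (par y)"
proof
  have "0 < y" using y by (simp add: pend_def)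
  then show "part i (par y) \<inter> desc y = {}" 
    using part_disjoint y by blast
  show "E s t \<longleftrightarrow> s = par y \<and> t \<in> {y}" if "s \<in> part i (par y)" "t \<in> desc y" for s t
    using part_edge[of y s i t] edge_par_desc[of y t] that y \<open>0 < y\<close> by auto
qed (use sym desc_self y FX self_in_part in auto)

lemma gluing_closed:
  assumes y: "0 < y" "y < n" "\<not> pend y" 
  shows "gluing E (part (Suc y) (par y)) (desc y) {y, tip y} {} {} (par y)"
proof
  show "part (Suc y) (par y) \<inter> desc y = {}" 
    using part_disjoint y by blast
  show "E s t \<longleftrightarrow> s = par y \<and> t \<in> {y, tip y}" if "s \<in> part (Suc y) (par y)" "t \<in> desc y" for s t
    using part_edge[of y s i t] edge_par_desc[of y t] that y by auto
qed (use sym desc_self tip_in_desc y self_in_part in auto)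

text \<open>An open cycle has its far end strictly above \<open>par y\<close>. So the root has no
  pending child, and its part is the whole graph once all other positions are processed.\<close>

lemma pend_par_pos:
  assumes "y < n" "pend y"
  shows "0 < par y"
proof -
  obtain x r where "cov y x r" "r \<noteq> par y" "0 < y"
    using assms by (auto simp: pend_def)
  then have "r \<le> par y" "r \<noteq> par y"
    using coversD(8)[OF _ assms(1)] by blast+
  then show ?thesis
    by simp
qed

lemma part_root: "part 1 0 = {..<n}"
proof -
  have "par y \<noteq> 0" if "y < n" "pend y" for y
    using pend_par_pos[OF that] by simp
  then have none: "{y. y < n \<and> 0 < y \<and> par y = 0 \<and> pend y} = {}"
    by blast
  have "desc 0 = part (Suc 0) 0"
    unfolding desc_parts[OF n_pos] none by simp
  then show ?thesis
    by (simp add: desc_zero)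
qed

end

section \<open>Triples of values for hanging parts and open cycles\<close>

definition rep ::
    "(nat \<Rightarrow> real) \<Rightarrow> (nat \<Rightarrow> nat \<Rightarrow> bool) \<Rightarrow> (nat list \<Rightarrow> real) \<Rightarrow> nat \<Rightarrow> nat \<Rightarrow>
     nat set \<Rightarrow> nat set \<Rightarrow> nat set \<Rightarrow> bool" where
  "rep W E t k v S F X \<longleftrightarrow>
     t [k, v] = val W (fam E S (insert v F) X) \<and>
     t [k + 1, v] = val W (fam E S F X) \<and>
     t [k + 2, v] = val W (fam E S F (insert v X))"

context dfs_cactus
begin

definition own where
  "own W t i v \<longleftrightarrow> t [0, v] = val W (fam E (part i v) {v} {}) \<and>
     t [1, v] = val W (fam E (part i v) {} {}) \<and> t [2, v] = val W (fam E (part i v) {} {v})"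

text \<open>
  The three triples assume that the far end of the back edge, at the other side of \<open>tip v\<close>,
  is chosen; that it gets no help from the back edge; or that \<open>tip v\<close> has to dominate it.
\<close>

definition tab where
  "tab W t v \<longleftrightarrow> rep W E t 3 v (desc v) {} {tip v} \<and> rep W E t 6 v (desc v) {} {} \<and>
     rep W E t 9 v (desc v) {tip v} {}"

lemma desc_pend:
  assumes "y < n" "pend y"
  shows "desc (par y) = part (Suc (par y)) (par y) \<union> desc y"
proof -
  have "0 < y" using assms by (simp add: pend_def)
  then have "{z. z < n \<and> 0 < z \<and> par z = par y \<and> pend z} = {y}"
    using pend_unique assms by blast
  moreover have "par y < n"
    using par_less[OF \<open>0 < y\<close> assms(1)] assms(1) by simp
  ultimately show ?thesis
    using desc_parts[of "par y"] by simp
qed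

lemma desc_no_pend:
  assumes "v < n" "\<nexists>y. y < n \<and> v < y \<and> par y = v \<and> pend y"
  shows "desc v = part (Suc v) v"
proof -
  have "{y. y < n \<and> 0 < y \<and> par y = v \<and> pend y} = {}"
    using assms par_less by blast
  then show ?thesis
    using desc_parts[OF assms(1)] by (metis (no_types, lifting) UN_empty sup_bot_right)
qed

text \<open>Choosing \<open>v\<close> exempts \<open>y\<close> (row \<open>k + 2\<close>), and
  \<open>v\<close> can be dominated by forcing \<open>y\<close> (row \<open>k\<close>). The
  conditions \<open>F\<close> and \<open>X\<close>, which concern the far end of the path, pass
  through unchanged.\<close>

lemma rep_extend:
  assumes y: "y < n" "pend y" and v: "v = par y"
    and own: "own W t (Suc v) v" and rep: "rep W E t k y (desc y) F X"
    and FX: "F \<subseteq> desc y" "X \<subseteq> desc y"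
    and t': "t' [k, v] = t [0, v] + t [k + 2, y]"
      "t' [k + 1, v] = min (min (t [1, v] + t [k + 1, y]) (t' [k, v])) (t [2, v] + t [k, y])"
      "t' [k + 2, v] = min (t [2, v] + t [k + 1, y]) (t' [k, v])"
  shows "rep W E t' k v (desc v) F X"
proof -
  let ?S = "part (Suc v) v" and ?U = "desc y"
  have desc: "desc v = ?S \<union> ?U"
    using desc_pend[OF y] v by simp
  interpret gluing E ?S ?U "{y}" F X v
    unfolding v using gluing_pend[OF y FX] .
  have fin: "finite ?S" "finite ?U" by simp_all
  have "t' [k, v] = val W (fam E (?S \<union> ?U) (insert v F) X)"
    using val_glue_forced[OF fin] own rep t'(1) by (simp add: own_def rep_def)
  then show ?thesis
    using val_glue_exempt[OF fin, of W] val_glue[OF fin, of y y W] own rep t'(2,3)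
    by (simp add: own_def rep_def desc ac_simps)
qed

lemma tab_extend:
  assumes y: "y < n" "pend y" and v: "v = par y" and own: "own W t (Suc v) v" and tab: "tab W t y"
    and t': "\<And>k. k \<in> {3, 6, 9} \<Longrightarrow> t' [k, v] = t [0, v] + t [k + 2, y] \<and>
      t' [k + 1, v] = min (min (t [1, v] + t [k + 1, y]) (t' [k, v])) (t [2, v] + t [k, y]) \<and>
      t' [k + 2, v] = min (t [2, v] + t [k + 1, y]) (t' [k, v])"
  shows "tab W t' v"
proof -
  have "0 < y" using y by (simp add: pend_def)
  then have "v < n"
    using par_less[of y] y v by simp
  then have tip: "tip v = tip y"
    using tip_child y v by blast
  note ext = rep_extend[OF y v own]
  show ?thesis
    unfolding tab_def tip
    using tab t' tip_in_desc[OF y(1)] by (auto simp only: tab_def intro!: ext)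
qed

text \<open>A path starts at \<open>v\<close>, which is both of its ends. Forcing either end selects
  entry 0, and exempting an end that is not forced selects entry 2.\<close>

lemma tab_copy:
  assumes "v < n" "\<nexists>y. y < n \<and> v < y \<and> par y = v \<and> pend y" and own: "own W t (Suc v) v"
    and t': "t' [3, v] = t [0, v]" "t' [4, v] = t [2, v]" "t' [5, v] = t [2, v]"
      "t' [6, v] = t [0, v]" "t' [7, v] = t [1, v]" "t' [8, v] = t [2, v]"
      "t' [9, v] = t [0, v]" "t' [10, v] = t [0, v]" "t' [11, v] = t [0, v]"
  shows "tab W t' v"
  using own t' fam_exempt_forced[of E "desc v" v "{}" "{}"]
  unfolding own_def tab_def rep_def tip_childless[OF assms(1,2)] desc_no_pend[OF assms(1,2), symmetric]
  by simp

text \<open>In row 5 both \<open>y\<close> and \<open>tip y\<close> are exempt, in row 7 neither is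
  constrained further, row 6 forces \<open>y\<close> and row 10 forces \<open>tip y\<close>.\<close>

lemma own_close:
  assumes y: "0 < y" "y < n" "\<not> pend y" and v: "v = par y"
    and own: "own W t (Suc y) v" and tab: "tab W t y"
    and t': "t' [0, v] = t [0, v] + t [5, y]"
      "t' [1, v] = min (min (min (t' [0, v]) (t [1, v] + t [7, y])) (t [2, v] + t [6, y]))
         (t [2, v] + t [10, y])"
      "t' [2, v] = min (t' [0, v]) (t [2, v] + t [7, y])"
  shows "own W t' y v"
proof -
  let ?S = "part (Suc y) v" and ?U = "desc y"
  have part: "part y v = ?S \<union> ?U"
    using part_step_par[OF y] v by simp
  interpret gluing E ?S ?U "{y, tip y}" "{}" "{}" v
    unfolding v using gluing_closed[OF y] .
  have fin: "finite ?S" "finite ?U" by simp_all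
  have "t' [0, v] = val W (fam E (?S \<union> ?U) {v} {})"
    using val_glue_forced[OF fin, of W] own tab t'(1) by (simp add: own_def tab_def rep_def)
  then show ?thesis
    using val_glue_exempt[OF fin, of W] val_glue[OF fin, of y "tip y" W] own tab t'(2,3)
    by (simp add: own_def tab_def rep_def part)
qed

end

section \<open>Positions of a cactus in depth-first-search order\<close>

lemma first_in_eq:
  assumes "k < length xs" "xs ! k \<in> S" "\<forall>j<k. xs ! j \<notin> S"
  shows "first_in xs S = xs ! k"
proof -
  have "filter (\<lambda>v. v \<in> S) (take k xs) = []"
    using assms by (auto simp: filter_empty_conv in_set_conv_nth)
  then have "filter (\<lambda>v. v \<in> S) xs = filter (\<lambda>v. v \<in> S) (drop k xs)"
    by (metis append_Nil append_take_drop_id filter_append)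
  also have "drop k xs = xs ! k # drop (Suc k) xs"
    using assms by (simp add: Cons_nth_drop_Suc)
  finally show ?thesis
    using assms by (simp add: first_in_def)
qed

lemma first_in_le:
  assumes "k < length xs" "xs ! k \<in> S"
  shows "\<exists>j\<le>k. first_in xs S = xs ! j"
proof -
  define j where "j = (LEAST j. xs ! j \<in> S)"
  have "xs ! j \<in> S" "j \<le> k" "\<forall>i<j. xs ! i \<notin> S"
    unfolding j_def using assms by (auto intro: LeastI Least_le dest: not_less_Least)
  then show ?thesis
    using first_in_eq[of j xs S] assms by auto
qed

lemma cycle_verts_cycle_edges: "cycle_list K c \<Longrightarrow> cycle_verts (cycle_edges c) = set c"
proof -
  assume "cycle_list K c"
  then have "0 < length c"
    by (auto simp: cycle_list_def)
  then have "c ! (Suc i mod length c) \<in> set c" for i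
    by (intro nth_mem mod_less_divisor)
  then have "cycle_verts (cycle_edges c) \<subseteq> set c"
    by (auto simp: cycle_edges_def)
  moreover have "set c \<subseteq> cycle_verts (cycle_edges c)"
  proof
    fix x assume "x \<in> set c"
    then obtain i where "i < length c" "c ! i = x"
      by (auto simp: in_set_conv_nth)
    then show "x \<in> cycle_verts (cycle_edges c)"
      unfolding cycle_edges_def by blast
  qed
  ultimately show ?thesis ..
qed

text \<open>Such a list becomes the vertex list of a fundamental cycle; its decreasing order yields
  distinctness.\<close>

lemma (in dfs_tree) tree_path:
  "A r x \<Longrightarrow> x < n \<Longrightarrow> \<exists>p. p \<noteq> [] \<and> hd p = x \<and> List.last p = r \<and> sorted_wrt (>) p \<and>
     (\<forall>i. Suc i < length p \<longrightarrow> 0 < p ! i \<and> p ! i < n \<and> p ! Suc i = par (p ! i)) \<and>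
     set p = {a. A r a \<and> A a x}"
proof (induction rule: anc.induct)
  case (anc_refl x)
  have "{a. A x a \<and> A a x} = {x}"
  proof
    show "{a. A x a \<and> A a x} \<subseteq> {x}"
    proof
      fix a assume a: "a \<in> {a. A x a \<and> A a x}"
      then have "a \<le> x"
        using anc_le anc_refl by simp
      then show "a \<in> {x}"
        using a anc_le[of x a] anc_refl by simp
    qed
  qed (simp add: anc.anc_refl)
  then show ?case
    by (intro exI[of _ "[x]"]) simp
next
  case (anc_step x r)
  have px: "par x < x" using par_less anc_step by simp
  then obtain p where p: "p \<noteq> []" "hd p = par x" "List.last p = r" "sorted_wrt (>) p"
     "\<And>i. Suc i < length p \<Longrightarrow> 0 < p ! i \<and> p ! i < n \<and> p ! Suc i = par (p ! i)"
     "set p = {a. A r a \<and> A a (par x)}"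
    using anc_step by auto
  have "A a x \<longleftrightarrow> a = x \<or> A a (par x)" for a
    using anc_par[of a x] anc.anc_step[OF \<open>0 < x\<close>, of par a] anc.anc_refl[of par x] by blast
  moreover have "A r x"
    using anc.anc_step anc_step.hyps by blast
  ultimately have "set (x # p) = {a. A r a \<and> A a x}"
    using p(6) by auto
  moreover have "a \<le> par x" if "a \<in> set p" for a
    using that p(6) anc_le[of a "par x"] px anc_step.prems by simp
  then have "sorted_wrt (>) (x # p)"
    using p(4) px by fastforce
  moreover have "\<forall>i. Suc i < length (x # p) \<longrightarrow>
      0 < (x # p) ! i \<and> (x # p) ! i < n \<and> (x # p) ! Suc i = par ((x # p) ! i)"
    using p anc_step by (auto simp: nth_Cons' hd_conv_nth gr0_conv_Suc)
  ultimately show ?case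
    using p by (intro exI[of _ "x # p"]) simp
qed

section \<open>A cactus with its search data, seen through positions\<close>

locale cactus_input =
  fixes K :: "nat pair_pre_digraph" and xs :: "nat list" and fa cf :: "nat \<Rightarrow> nat"
  assumes cactus: "cactus K" and data: "dfs_data K xs fa cf"
begin

definition idx :: "nat \<Rightarrow> nat" where "idx v = (THE k. k < length xs \<and> xs ! k = v)"
definition E :: "nat \<Rightarrow> nat \<Rightarrow> bool" where
  "E j k \<longleftrightarrow> j < length xs \<and> k < length xs \<and> (xs ! j, xs ! k) \<in> parcs K"
definition par :: "nat \<Rightarrow> nat" where "par k = idx (fa (xs ! k))"
definition cfi :: "nat \<Rightarrow> nat" where "cfi k = idx (cf (xs ! k))"

lemma order: "dfs_order K xs fa" and firsts: "cycle_firsts K xs cf"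
  using data by (auto simp: dfs_data_def)

lemma distinct: "distinct xs" and set_xs: "set xs = pverts K" and root: "fa (hd xs) = hd xs"
  using order by (auto simp: dfs_order_def)

lemma length_xs: "length xs = card (pverts K)"
  using distinct set_xs distinct_card by metis

lemma idx_nth [simp]: "k < length xs \<Longrightarrow> idx (xs ! k) = k"
  unfolding idx_def using distinct by (auto simp: nth_eq_iff_index_eq)

lemma nth_idx: "v \<in> pverts K \<Longrightarrow> idx v < length xs \<and> xs ! idx v = v"
  using set_xs idx_nth by (metis in_set_conv_nth)

lemma xs_nonempty: "xs \<noteq> []"
proof -
  have "pverts K \<noteq> {}"
    using cactus by (auto simp: cactus_def connected_def strongly_connected_def)
  then show ?thesis
    using set_xs by auto
qed

lemma nth_in: "k < length xs \<Longrightarrow> xs ! k \<in> pverts K"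
  using set_xs nth_mem by blast

lemma fa_nth: "k < length xs \<Longrightarrow> fa (xs ! k) = xs ! par k \<and> par k < length xs"
proof (cases "k = 0")
  case True
  then have "fa (xs ! k) = xs ! 0"
    using root xs_nonempty by (simp add: hd_conv_nth)
  then show ?thesis
    using True xs_nonempty by (simp add: par_def)
next
  case False
  assume "k < length xs"
  then obtain j where "j < k" "fa (xs ! k) = xs ! j"
    using order False by (auto simp: dfs_order_def)
  then show ?thesis
    using \<open>k < length xs\<close> by (simp add: par_def)
qed

sublocale dfs_tree "length xs" par E
proof
  interpret pair_graph K
    using cactus by (simp add: cactus_def)
  show "0 < length xs"
    using xs_nonempty by simp
  show "E j i" if "E i j" for i j
    using that arcs_symmetric by (simp add: E_def)
  show "\<not> E i i" for i
    using no_loops' by (auto simp: E_def)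
  show "i < length xs" if "E i j" for i j
    using that by (simp add: E_def)
  have step: "par i < i \<and> E (par i) i \<and> (\<forall>k u. par i < k \<and> k < i \<and> E k u \<longrightarrow> u < i)"
    if i: "0 < i" "i < length xs" for i
  proof -
    obtain j where j: "j < i" "fa (xs ! i) = xs ! j" "(xs ! j, xs ! i) \<in> parcs K"
      "\<And>k u. j < k \<Longrightarrow> k < i \<Longrightarrow> (xs ! k, u) \<in> parcs K \<Longrightarrow> u \<in> set (take i xs)"
      using order i by (auto simp: dfs_order_def)
    then have "par i = j"
      using i by (simp add: par_def)
    moreover have "u < i" if u: "j < k" "k < i" "E k u" for k u
    proof -
      have "xs ! u \<in> set (take i xs)"
        using u j(4) by (simp add: E_def)
      then obtain u' where "u' < i" "xs ! u = xs ! u'"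
        using i by (auto simp: in_set_conv_nth)
      then show ?thesis
        using distinct u i by (simp add: E_def nth_eq_iff_index_eq)
    qed
    ultimately show ?thesis
      using j i by (auto simp: E_def)
  qed
  show "par i < i" "E (par i) i" if "0 < i" "i < length xs" for i
    using step that by blast+
  show "u < i" if "i < length xs" "par i < k" "k < i" "E k u" for i k u
    using step[of i] that by auto
qed

text \<open>By the last conjunct the back edge is the only edge outside the tree, so the edge set of
  the cycle determines it.\<close>

definition fcycle where
  "fcycle x r c \<longleftrightarrow> cycle_list K c \<and> set c = (!) xs ` {a. A r a \<and> A a x} \<and>
     {xs ! x, xs ! r} \<in> cycle_edges c \<and>
     (\<forall>e\<in>cycle_edges c. e = {xs ! x, xs ! r} \<or> (\<exists>a. 0 < a \<and> a < length xs \<and> e = {xs ! a, xs ! par a}))"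

lemma fundamental_cycle:
  assumes "A r x" "E r x" "r < x" "r \<noteq> par x"
  shows "\<exists>c. fcycle x r c"
proof -
  have x: "x < length xs"
    using assms by (simp add: E_def)
  then obtain p where p: "p \<noteq> []" "hd p = x" "List.last p = r" "sorted_wrt (>) p"
     "\<And>i. Suc i < length p \<Longrightarrow> 0 < p ! i \<and> p ! i < length xs \<and> p ! Suc i = par (p ! i)"
     "set p = {a. A r a \<and> A a x}"
    using tree_path[OF assms(1)] by blast
  define c where "c = map ((!) xs) p"
  have less: "a < length xs" if "a \<in> set p" for a
    using that p(6) anc_le[of a x] x by simp
  have len: "3 \<le> length p"
  proof (rule ccontr)
    assume "\<not> 3 \<le> length p"
    moreover have "length p \<noteq> 0" using p(1) by simp
    ultimately consider "length p = 1" | "length p = 2" by linarith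
    then show False
    proof cases
      case 1
      then show False
        using p(2,3) assms by (auto simp: hd_conv_nth last_conv_nth p(1))
    next
      case 2
      then have "r = par x"
        using p(2,3) p(5)[of 0] by (simp add: hd_conv_nth last_conv_nth p(1))
      then show False using assms by simp
    qed
  qed
  have dist: "distinct c"
  proof -
    have "distinct p"
      using p(4) by (simp add: distinct_conv_nth sorted_wrt_iff_nth_less)
        (metis less_irrefl_nat linorder_neqE_nat)
    moreover have "inj_on ((!) xs) (set p)"
      using less distinct by (auto simp: inj_on_def nth_eq_iff_index_eq)
    ultimately show ?thesis
      by (simp add: c_def distinct_map)
  qed
  have ends: "p ! 0 = x" "p ! (length p - 1) = r"
    using p(1-3) by (simp_all add: hd_conv_nth last_conv_nth)
  \<comment> \<open>All indices but the last follow tree edges upwards; the last one wraps around by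
    \<open>mod\<close> and is the back edge.\<close>
  have edge: "(Suc i < length c \<and> 0 < p ! i \<and> p ! i < length xs \<and> c ! i = xs ! (p ! i) \<and>
        c ! (Suc i mod length c) = xs ! par (p ! i)) \<or>
      (i = length c - 1 \<and> c ! i = xs ! r \<and> c ! (Suc i mod length c) = xs ! x)"
    if "i < length c" for i
  proof (cases "Suc i < length p")
    case True
    then show ?thesis
      using p(5)[OF True] by (simp add: c_def)
  next
    case False
    then have "i = length p - 1" "Suc i = length c"
      using that by (auto simp: c_def)
    then show ?thesis
      using that ends p(1) by (simp add: c_def)
  qed
  have "(c ! i, c ! (Suc i mod length c)) \<in> parcs K" if "i < length c" for i
    using edge[OF that]
  proof (elim disjE conjE)
    assume "0 < p ! i" "p ! i < length xs" "c ! i = xs ! (p ! i)"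
      "c ! (Suc i mod length c) = xs ! par (p ! i)"
    then show ?thesis
      using sym[OF par_edge[of "p ! i"]] by (simp add: E_def)
  next
    assume "c ! i = xs ! r" "c ! (Suc i mod length c) = xs ! x"
    then show ?thesis
      using assms by (simp add: E_def)
  qed
  then have cyc: "cycle_list K c"
    using len dist by (simp add: cycle_list_def c_def)
  have "length c - 1 < length c"
    using p(1) by (simp add: c_def)
  then have "{xs ! x, xs ! r} \<in> cycle_edges c"
    unfolding cycle_edges_def using edge[of "length c - 1"]
    by (intro CollectI exI[of _ "length c - 1"]) (auto simp: insert_commute)
  moreover have "e = {xs ! x, xs ! r} \<or> (\<exists>a. 0 < a \<and> a < length xs \<and> e = {xs ! a, xs ! par a})"
    if e: "e \<in> cycle_edges c" for e
  proof -
    obtain i where "i < length c" "e = {c ! i, c ! (Suc i mod length c)}"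
      using e by (auto simp: cycle_edges_def)
    from edge[OF this(1)] this(2) show ?thesis
      by (elim disjE conjE) (simp_all add: insert_commute, blast)
  qed
  ultimately have "fcycle x r c"
    unfolding fcycle_def using cyc p(6) by (simp add: c_def)
  then show ?thesis by blast
qed

lemma covers_fcycle:
  assumes "v < length xs" "cov v x r"
  shows "\<exists>c. fcycle x r c"
  using coversD[OF assms(2,1)] anc_trans by (intro fundamental_cycle) auto

lemma fcycle_verts:
  assumes "v < length xs" "cov v x r" "fcycle x r c"
  shows "xs ! v \<in> set c" "xs ! par v \<in> set c"
proof -
  note d = coversD[OF assms(2,1)]
  have "A (par v) v"
    using d(3) by (intro anc_step[OF _ anc_refl]) simp
  then show "xs ! v \<in> set c" "xs ! par v \<in> set c"
    using assms(3) d anc_trans[of v x "par v"] unfolding fcycle_def by blast+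
qed

text \<open>Two back edges covering the edge from \<open>v\<close> to \<open>par v\<close> give two
  fundamental cycles that share both vertices. In a cactus these have the same edges, hence the same
  single non-tree edge.\<close>

sublocale dfs_cactus "length xs" par E cfi
proof
  fix v x r x' r' assume v: "v < length xs" and c: "cov v x r" "cov v x' r'"
  note d = coversD[OF c(1) v] and d' = coversD[OF c(2) v]
  obtain C C' where C: "fcycle x r C" "fcycle x' r' C'"
    using covers_fcycle v c by meson
  have pv: "par v < v"
    using par_less v d(3) by simp
  then have "xs ! v \<noteq> xs ! par v"
    using distinct v by (simp add: nth_eq_iff_index_eq)
  moreover have sub: "{xs ! v, xs ! par v} \<subseteq> set C \<inter> set C'"
    using fcycle_verts[OF v] c C by blast
  ultimately have two: "2 \<le> card (set C \<inter> set C')"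
    using card_mono[OF _ sub] by simp
  have cyc: "cycle_list K C" "cycle_list K C'"
    using C by (auto simp: fcycle_def)
  have "cycle_edges C = cycle_edges C'"
  proof (rule ccontr)
    assume "cycle_edges C \<noteq> cycle_edges C'"
    moreover have "cycle_edges C \<in> cycles K" "cycle_edges C' \<in> cycles K"
      using cyc by (auto simp: cycles_def)
    ultimately have "card (cycle_verts (cycle_edges C) \<inter> cycle_verts (cycle_edges C')) \<le> 1"
      using cactus unfolding cactus_def by blast
    then show False
      using two cyc by (simp add: cycle_verts_cycle_edges)
  qed
  then have "{xs ! x, xs ! r} \<in> cycle_edges C'"
    using C by (auto simp: fcycle_def)
  then consider "{xs ! x, xs ! r} = {xs ! x', xs ! r'}"
    | a where "0 < a" "a < length xs" "{xs ! x, xs ! r} = {xs ! a, xs ! par a}"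
    using C by (auto simp: fcycle_def)
  then show "x' = x \<and> r' = r"
  proof cases
    case 1
    then show ?thesis
      using distinct d d' v by (auto simp: doubleton_eq_iff nth_eq_iff_index_eq)
  next
    case 2
    then have "par a < a"
      using par_less by blast
    then show ?thesis
      using 2 distinct d v by (auto simp: doubleton_eq_iff nth_eq_iff_index_eq)
  qed
next
  fix v x r assume v: "v < length xs" and c: "cov v x r"
  note d = coversD[OF c v]
  obtain C where C: "fcycle x r C"
    using covers_fcycle v c by meson
  then have cyc: "cycle_list K C"
    by (simp add: fcycle_def)
  \<comment> \<open>The far end \<open>r\<close> is an ancestor of every vertex of the cycle, hence
    visited first.\<close>
  have "first_in xs (set C) = xs ! r"
  proof (rule first_in_eq)
    show r: "r < length xs" using d v by simp
    show "xs ! r \<in> set C"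
      using C d anc_trans[of v x r] unfolding fcycle_def by (auto intro: anc.anc_refl)
    show "\<forall>j<r. xs ! j \<notin> set C"
    proof (intro allI impI notI)
      fix j assume j: "j < r" "xs ! j \<in> set C"
      then obtain a where a: "A r a" "A a x" "xs ! j = xs ! a"
        using C by (auto simp: fcycle_def)
      then have "a < length xs"
        using anc_le[of a x] d by simp
      then show False
        using a j r distinct anc_le[of r a] by (simp add: nth_eq_iff_index_eq)
    qed
  qed
  moreover have "xs ! v \<noteq> xs ! r"
    using d v distinct by (simp add: nth_eq_iff_index_eq)
  ultimately have "cf (xs ! v) = xs ! r"
    using firsts fcycle_verts(1)[OF v c C] cyc cycle_verts_cycle_edges[OF cyc]
    unfolding cycle_firsts_def cycles_def by (metis imageI mem_Collect_eq)
  then show "cfi v = r"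
    using d v by (simp add: cfi_def)
next
  fix v assume v: "v < length xs" and e: "E (cfi v) v"
  show "cfi v < v"
  proof (cases "\<forall>C\<in>cycles K. xs ! v \<in> cycle_verts C \<longrightarrow> xs ! v = first_in xs (cycle_verts C)")
    case True
    \<comment> \<open>Here the stored vertex is the default, and the assumed edge would be a
      loop.\<close>
    then have "cf (xs ! v) = xs ! v"
      using firsts nth_in[OF v] unfolding cycle_firsts_def by blast
    then show ?thesis
      using e v irrefl by (simp add: cfi_def)
  next
    case False
    then obtain C where C: "C \<in> cycles K" "xs ! v \<in> cycle_verts C" "xs ! v \<noteq> first_in xs (cycle_verts C)"
      by blast
    then have "cf (xs ! v) = first_in xs (cycle_verts C)"
      using firsts unfolding cycle_firsts_def by blast
    moreover obtain j where "j \<le> v" "first_in xs (cycle_verts C) = xs ! j"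
      using first_in_le[OF v C(2)] by blast
    ultimately show ?thesis
      using C(3) v by (cases "j = v") (simp_all add: cfi_def)
  qed
qed

lemma cf_nth:
  assumes "k < length xs"
  shows "cf (xs ! k) = xs ! cfi k \<and> cfi k < length xs"
proof -
  have "cf (xs ! k) \<in> pverts K"
  proof (cases "\<forall>C\<in>cycles K. xs ! k \<in> cycle_verts C \<longrightarrow> xs ! k = first_in xs (cycle_verts C)")
    case True
    then have "cf (xs ! k) = xs ! k"
      using firsts nth_in[OF assms] unfolding cycle_firsts_def by blast
    then show ?thesis
      using nth_in assms by simp
  next
    case False
    then obtain C where C: "C \<in> cycles K" "xs ! k \<in> cycle_verts C" "xs ! k \<noteq> first_in xs (cycle_verts C)"
      by blast
    then have "cf (xs ! k) = first_in xs (cycle_verts C)"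
      using firsts unfolding cycle_firsts_def by blast
    then show ?thesis
      using first_in_le[OF assms C(2)] nth_in assms by (metis le_less_trans)
  qed
  then show ?thesis
    using nth_idx by (simp add: cfi_def)
qed

lemma weighted_domination_number_eq:
  "weighted_domination_number K w = val (w \<circ> (!) xs) (fam E {..<length xs} {} {})"
proof -
  have inj: "inj_on ((!) xs) {..<length xs}"
    using distinct by (auto simp: inj_on_def nth_eq_iff_index_eq)
  have V: "pverts K = (!) xs ` {..<length xs}"
    using set_xs by (metis lessThan_atLeast0 list.set_map map_nth set_upt)
  have dom: "dominating_set K ((!) xs ` D) \<longleftrightarrow> D \<in> fam E {..<length xs} {} {}" if D: "D \<subseteq> {..<length xs}" for D
  proof -
    have "xs ! k \<in> (!) xs ` D \<longleftrightarrow> k \<in> D" if "k < length xs" for k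
      using D that inj by (auto dest: inj_onD)
    then show ?thesis
      using D unfolding dominating_set_def V fam_def dominated_def E_def
      by (auto simp: subset_eq)
  qed
  have "{D. dominating_set K D} = ((`) ((!) xs)) ` fam E {..<length xs} {} {}"
  proof (intro equalityI subsetI)
    fix D assume D: "D \<in> {D. dominating_set K D}"
    then have "D \<subseteq> (!) xs ` {..<length xs}"
      using V by (simp add: dominating_set_def)
    then obtain D' where "D' \<subseteq> {..<length xs}" "D = (!) xs ` D'"
      by (meson subset_imageE)
    then show "D \<in> ((`) ((!) xs)) ` fam E {..<length xs} {} {}"
      using dom D by blast
  next
    fix D assume "D \<in> ((`) ((!) xs)) ` fam E {..<length xs} {} {}"
    then obtain D' where D': "D' \<in> fam E {..<length xs} {} {}" "D = (!) xs ` D'"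
      by blast
    then have "D' \<subseteq> {..<length xs}"
      by (auto simp: fam_def)
    then show "D \<in> {D. dominating_set K D}"
      using dom D' by blast
  qed
  moreover have "sum w ((!) xs ` D) = sum (w \<circ> (!) xs) D" if "D \<in> fam E {..<length xs} {} {}" for D
    using that inj by (intro sum.reindex) (auto simp: fam_def intro: inj_on_subset)
  ultimately show ?thesis
    unfolding weighted_domination_number_def val_def by (simp add: image_image)
qed

end

section \<open>One step of the dynamic program\<close>

context dfs_cactus
begin

text \<open>Only fathers \<open>v < i\<close> are constrained; the cells of processed positions keep
  stale entries.\<close>

definition pending where
  "pending i ch \<longleftrightarrow> (\<forall>v<i. (\<forall>y. i \<le> y \<and> y < n \<and> pend y \<and> par y = v \<longrightarrow> ch v = y) \<and>
     (ch v \<noteq> 0 \<longrightarrow> i \<le> ch v \<and> ch v < n \<and> pend (ch v) \<and> par (ch v) = v))"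

text \<open>A pending \<open>y\<close> with \<open>i \<le> par y\<close> has already been absorbed
  by its father, so its rows are no longer required.\<close>

definition tables where
  "tables W i t \<longleftrightarrow> (\<forall>v<i. own W t i v) \<and> (\<forall>y. i \<le> y \<and> y < n \<and> pend y \<and> par y < i \<longrightarrow> tab W t y)"

text \<open>
  Every processed position that is no longer pending pays for the single
  closing or extending step that has absorbed it.
\<close>

definition cost_bound :: "nat \<Rightarrow> nat \<Rightarrow> (nat \<Rightarrow> nat) \<Rightarrow> nat \<Rightarrow> bool" where
  "cost_bound c i ch p \<longleftrightarrow> p + c * card {k. k < i \<and> ch k \<noteq> 0} \<le> c * (n - i)"

lemma pending_child:
  assumes "pending (Suc v) ch" "v < n"
  shows "ch v \<noteq> 0 \<longleftrightarrow> (\<exists>y. y < n \<and> v < y \<and> par y = v \<and> pend y)"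
    and "ch v \<noteq> 0 \<Longrightarrow> v < ch v \<and> ch v < n \<and> pend (ch v) \<and> par (ch v) = v"
  using assms unfolding pending_def by (auto simp: Suc_le_eq)

lemma pendingD:
  assumes "pending i ch" "v < i"
  shows "i \<le> y \<Longrightarrow> y < n \<Longrightarrow> pend y \<Longrightarrow> par y = v \<Longrightarrow> ch v = y"
    and "ch v \<noteq> 0 \<Longrightarrow> i \<le> ch v \<and> ch v < n \<and> pend (ch v) \<and> par (ch v) = v"
  using assms unfolding pending_def by blast+

text \<open>One cell per father suffices because of \<open>pend_unique\<close>: storing
  \<open>v\<close> cannot displace another pending child.\<close>

lemma pending_step:
  assumes ch: "pending (Suc v) ch" and v: "v < n"
  shows "pend v \<Longrightarrow> pending v (ch(par v := v))" and "\<not> pend v \<Longrightarrow> pending v ch"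
proof -
  have up: "Suc v \<le> y" if "v \<le> y" "y \<noteq> v" for y
    using that by simp
  have old: "ch u = y" if "u < v" "Suc v \<le> y" "y < n" "pend y" "par y = u" for u y
    using pendingD(1)[OF ch less_SucI] that by blast
  have old': "v \<le> ch u \<and> ch u < n \<and> pend (ch u) \<and> par (ch u) = u" if "u < v" "ch u \<noteq> 0" for u
    using pendingD(2)[OF ch less_SucI] that Suc_leD by blast
  show "pending v ch" if "\<not> pend v"
    unfolding pending_def using old old' up that by blast
  show "pending v (ch(par v := v))" if "pend v"
    unfolding pending_def
  proof (intro allI impI)
    fix u assume u: "u < v"
    let ?c = "(ch(par v := v)) u"
    show "(\<forall>y. v \<le> y \<and> y < n \<and> pend y \<and> par y = u \<longrightarrow> ?c = y) \<and>
       (?c \<noteq> 0 \<longrightarrow> v \<le> ?c \<and> ?c < n \<and> pend ?c \<and> par ?c = u)"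
    proof (cases "u = par v")
      case True
      then show ?thesis
        using that v pend_unique[OF v _ that] by simp
    next
      case False
      then have "?c = ch u" "\<And>y. par y = u \<Longrightarrow> y \<noteq> v"
        by auto
      then show ?thesis
        using old[OF u] old'[OF u] up by metis
    qed
  qed
qed

lemma tab_cong: "(\<And>k. t' [k, v] = t [k, v]) \<Longrightarrow> tab W t' v = tab W t v"
  by (simp add: tab_def rep_def)

lemma tab_step:
  assumes ch: "pending (Suc v) ch" and t: "tables W (Suc v) t" and v: "v < n"
    and ext: "\<And>k. ch v \<noteq> 0 \<Longrightarrow> k \<in> {3, 6, 9} \<Longrightarrow>
      t' [k, v] = t [0, v] + t [k + 2, ch v] \<and>
      t' [k + 1, v] = min (min (t [1, v] + t [k + 1, ch v]) (t' [k, v])) (t [2, v] + t [k, ch v]) \<and>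
      t' [k + 2, v] = min (t [2, v] + t [k + 1, ch v]) (t' [k, v])"
    and copy: "ch v = 0 \<Longrightarrow> t' [3, v] = t [0, v] \<and> t' [4, v] = t [2, v] \<and> t' [5, v] = t [2, v] \<and>
      t' [6, v] = t [0, v] \<and> t' [7, v] = t [1, v] \<and> t' [8, v] = t [2, v] \<and>
      t' [9, v] = t [0, v] \<and> t' [10, v] = t [0, v] \<and> t' [11, v] = t [0, v]"
  shows "tab W t' v"
proof (cases "ch v = 0")
  case True
  then have "\<nexists>y. y < n \<and> v < y \<and> par y = v \<and> pend y"
    using pending_child[OF ch v] by blast
  moreover have "own W t (Suc v) v"
    using t by (simp add: tables_def)
  ultimately show ?thesis
    using copy[OF True] by (intro tab_copy[OF v]) auto
next
  case False
  then have c: "v < ch v" "ch v < n" "pend (ch v)" "v = par (ch v)"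
    using pending_child[OF ch v] by auto
  have "own W t (Suc v) v" "tab W t (ch v)"
    using t c unfolding tables_def by auto
  then show ?thesis
    using ext[OF False] by (rule tab_extend[OF c(2,3,4)])
qed

lemma tables_pend:
  assumes t: "tables W (Suc v) t" and "pend v" and "tab W t' v"
    and frame: "\<And>k u. u \<noteq> v \<Longrightarrow> t' [k, u] = t [k, u]"
  shows "tables W v t'"
  unfolding tables_def
proof (intro conjI allI impI)
  fix u assume u: "u < v"
  then have "own W t v u"
    using t part_step_other[of u v] \<open>pend v\<close> by (simp add: tables_def own_def)
  then show "own W t' v u"
    using frame u by (simp add: own_def)
next
  fix y assume y: "v \<le> y \<and> y < n \<and> pend y \<and> par y < v"
  show "tab W t' y"
  proof (cases "y = v")
    case False
    then have "tab W t y"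
      using t y by (simp add: tables_def)
    then show ?thesis
      using tab_cong frame False by blast
  qed (simp add: \<open>tab W t' v\<close>)
qed

text \<open>Closing writes only rows below 3, and only at the father, so the triples of the other
  open cycles survive.\<close>

lemma tables_close:
  assumes t: "tables W (Suc v) t" and v: "0 < v" "v < n" and "\<not> pend v" and "tab W t1 v"
    and frame: "\<And>k u. u \<noteq> v \<Longrightarrow> t1 [k, u] = t [k, u]"
    and close: "t' [0, par v] = t1 [0, par v] + t1 [5, v]"
      "t' [1, par v] = min (min (min (t' [0, par v]) (t1 [1, par v] + t1 [7, v])) (t1 [2, par v] + t1 [6, v]))
         (t1 [2, par v] + t1 [10, v])"
      "t' [2, par v] = min (t' [0, par v]) (t1 [2, par v] + t1 [7, v])"
    and frame': "\<And>k u. u \<noteq> par v \<or> 3 \<le> k \<Longrightarrow> t' [k, u] = t1 [k, u]"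
  shows "tables W v t'"
  unfolding tables_def
proof (intro conjI allI impI)
  have pv: "par v < v"
    using par_less v by simp
  have own1: "own W t1 (Suc v) u" if "u < v" for u
    using t frame that by (simp add: tables_def own_def)
  fix u assume u: "u < v"
  show "own W t' v u"
  proof (cases "u = par v")
    case True
    then show ?thesis
      using own_close[OF v \<open>\<not> pend v\<close> refl own1[OF pv] \<open>tab W t1 v\<close>] close by simp
  next
    case False
    then have "own W t1 v u"
      using own1[OF u] part_step_other[of u v] by (simp add: own_def)
    then show ?thesis
      using frame' False by (simp add: own_def)
  qed
next
  fix y assume y: "v \<le> y \<and> y < n \<and> pend y \<and> par y < v"
  then have "y \<noteq> v"
    using \<open>\<not> pend v\<close> by blast
  then have "tab W t y"
    using t y by (simp add: tables_def)
  moreover have "t' [k, y] = t [k, y]" if "3 \<le> k" for k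
    using frame frame' \<open>y \<noteq> v\<close> that by simp
  ultimately show "tab W t' y"
    by (simp add: tab_def rep_def)
qed

text \<open>Moving from \<open>Suc v\<close> to \<open>v\<close> drops the cell of \<open>v\<close>
  from the count, which pays \<open>a\<close>. The new position brings a further \<open>c\<close>:
  if \<open>v\<close> becomes pending it is held back for the later extension, otherwise it pays the
  closing cost \<open>b\<close> at once.\<close>

lemma cost_step:
  assumes cost: "cost_bound c (Suc v) ch p" and v: "v < n"
    and a: "a \<le> (if ch v \<noteq> 0 then c else 0)" and b: "b \<le> c"
  shows "cost_bound c v (ch(par v := v)) (p + a)" and "cost_bound c v ch (p + a + b)"
proof -
  let ?C = "\<lambda>ch i. {k. k < i \<and> ch k \<noteq> 0}"
  have fin: "finite (?C ch i)" for i and ch :: "nat \<Rightarrow> nat"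
    by simp
  have "?C ch (Suc v) = (if ch v \<noteq> 0 then insert v (?C ch v) else ?C ch v)"
    by (auto simp: less_Suc_eq)
  then have "card (?C ch (Suc v)) = card (?C ch v) + (if ch v \<noteq> 0 then 1 else 0)"
    using fin by simp
  then have "a + c * card (?C ch v) \<le> c * card (?C ch (Suc v))"
    using a by (simp split: if_splits)
  then have *: "p + a + c + c * card (?C ch v) \<le> c + c * (n - Suc v)"
    using cost unfolding cost_bound_def by simp
  have "c + c * (n - Suc v) = c * (n - v)"
    using v by (simp add: Suc_diff_Suc flip: mult_Suc_right)
  with * have **: "p + a + c + c * card (?C ch v) \<le> c * (n - v)"
    by simp
  then show "cost_bound c v ch (p + a + b)"
    using b unfolding cost_bound_def by simp
  have "?C (ch(par v := v)) v \<subseteq> insert (par v) (?C ch v)"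
    by auto
  then have "card (?C (ch(par v := v)) v) \<le> card (insert (par v) (?C ch v))"
    using fin by (intro card_mono) auto
  also have "\<dots> \<le> Suc (card (?C ch v))"
    using fin by (simp add: card_insert_if)
  finally have "card (?C (ch(par v := v)) v) \<le> Suc (card (?C ch v))" .
  then have "c * card (?C (ch(par v := v)) v) \<le> c * Suc (card (?C ch v))"
    by (rule mult_le_mono2)
  then show "cost_bound c v (ch(par v := v)) (p + a)"
    using ** unfolding cost_bound_def by simp
qed

lemma pending_n: "pending n (\<lambda>_. 0)"
  by (simp add: pending_def)

lemma tables_n:
  assumes "\<And>v. v < n \<Longrightarrow> 0 \<le> W v \<and> t [0, v] = W v \<and> t [1, v] = W v \<and> t [2, v] = 0"
  shows "tables W n t"
proof -
  \<comment> \<open>A lone vertex can be dominated only by itself. When it is exempt, the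
    nonnegative weight makes the empty set optimal.\<close>
  have "fam E {v} {v} {} = {{v}}" "fam E {v} {} {} = {{v}}" "fam E {v} {} {v} = {{}, {v}}" for v
    using irrefl by (auto simp: fam_def dominated_def subset_singleton_iff)
  then show ?thesis
    using assms unfolding tables_def own_def part_n val_def by auto
qed

lemma tables_1: "tables W 1 t \<Longrightarrow> t [1, 0] = val W (fam E {..<n} {} {})"
  by (simp add: tables_def own_def part_root flip: One_nat_def)

end

section \<open>The program\<close>

definition wp :: "com \<Rightarrow> (nat \<Rightarrow> nat \<Rightarrow> state \<Rightarrow> bool) \<Rightarrow> state \<Rightarrow> bool" where
  "wp c Q \<sigma> \<longleftrightarrow> (\<exists>p q \<tau>. exec c \<sigma> p q \<tau> \<and> Q p q \<tau>)"

text \<open>Determinism turns one known execution into an equation, so straight-line code can be run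
  by rewriting.\<close>

lemma wp_exec:
  assumes "exec c \<sigma> p q \<tau>"
  shows "wp c Q \<sigma> \<longleftrightarrow> Q p q \<tau>"
  unfolding wp_def using assms exec_deterministic[OF assms] by blast

lemma wp_Seq: "wp (Seq c d) Q \<sigma> \<longleftrightarrow> wp c (\<lambda>p q. wp d (\<lambda>p' q'. Q (p + p') (q + q'))) \<sigma>"
proof
  assume "wp (Seq c d) Q \<sigma>"
  then obtain p q \<tau> where "exec (Seq c d) \<sigma> p q \<tau>" "Q p q \<tau>"
    unfolding wp_def by blast
  then show "wp c (\<lambda>p q. wp d (\<lambda>p' q'. Q (p + p') (q + q'))) \<sigma>"
    unfolding wp_def by (elim SeqE) blast
next
  assume "wp c (\<lambda>p q. wp d (\<lambda>p' q'. Q (p + p') (q + q'))) \<sigma>"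
  then show "wp (Seq c d) Q \<sigma>"
    unfolding wp_def using exec.Seq by blast
qed

lemma wp_If: "wp (If b c d) Q \<sigma> \<longleftrightarrow> (if bval b (fst \<sigma>) then wp c Q \<sigma> else wp d Q \<sigma>)"
proof -
  have "exec (If b c d) \<sigma> p q \<tau> \<longleftrightarrow> exec (if bval b (fst \<sigma>) then c else d) \<sigma> p q \<tau>" for p q \<tau>
    using exec.IfTrue[of b \<sigma> c p q \<tau> d] exec.IfFalse[of b \<sigma> d p q \<tau> c]
    by (auto elim: IfE)
  then show ?thesis
    by (simp add: wp_def)
qed

lemmas wp_simps = wp_exec[OF exec.Assign] wp_exec[OF exec.WZero] wp_exec[OF exec.WCopy]
  wp_exec[OF exec.WAdd] wp_exec[OF exec.WMin] wp_Seq wp_If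

lemma wp_mono: "wp c Q \<sigma> \<Longrightarrow> (\<And>p q \<tau>. Q p q \<tau> \<Longrightarrow> Q' p q \<tau>) \<Longrightarrow> wp c Q' \<sigma>"
  unfolding wp_def by blast

text \<open>The index \<open>i\<close> is the termination measure. The arguments \<open>p\<close>
  and \<open>q\<close> of the invariant accumulate the cost already spent, so the bound need not be
  split over iterations.\<close>

lemma wp_While_countdown:
  assumes "a \<le> i" and "I i p q \<sigma>"
    and step: "\<And>i p q \<sigma>. a \<le> i \<Longrightarrow> I (Suc i) p q \<sigma> \<Longrightarrow>
      bval b (fst \<sigma>) \<and> wp c (\<lambda>p' q'. I i (p + p') (q + q')) \<sigma>"
    and stop: "\<And>p q \<sigma>. I a p q \<sigma> \<Longrightarrow> \<not> bval b (fst \<sigma>)"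
  shows "wp (While b c) (\<lambda>p' q'. I a (p + p') (q + q')) \<sigma>"
  using assms(1,2)
proof (induction i arbitrary: p q \<sigma> rule: dec_induct)
  case base
  then show ?case
    unfolding wp_def using stop exec.WhileFalse by (metis add.right_neutral)
next
  case (step i)
  then obtain p1 q1 \<sigma>1 where b: "bval b (fst \<sigma>)" and c: "exec c \<sigma> p1 q1 \<sigma>1"
    "I i (p + p1) (q + q1) \<sigma>1"
    using assms(3)[of i p q \<sigma>] unfolding wp_def by blast
  with step.IH[OF c(2)] obtain p2 q2 \<tau> where "exec (While b c) \<sigma>1 p2 q2 \<tau>"
    "I a (p + p1 + p2) (q + q1 + q2) \<tau>"
    unfolding wp_def by blast
  then show ?case
    unfolding wp_def using exec.WhileTrue[OF b c(1)] by (metis add.assoc)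
qed

section \<open>The text of the program\<close>

abbreviation pos_var :: aexp where "pos_var \<equiv> Cell ''i'' []"
abbreviation vertex :: aexp where "vertex \<equiv> Cell ''order'' [pos_var]"
abbreviation father_pos :: aexp where "father_pos \<equiv> Cell ''pos'' [Cell ''father'' [vertex]]"
abbreviation first_vertex :: aexp where "first_vertex \<equiv> Cell ''first'' [vertex]"
abbreviation child :: aexp where "child \<equiv> Cell ''child'' [pos_var]"
abbreviation T :: "nat \<Rightarrow> aexp \<Rightarrow> loc" where "T k e \<equiv> Loc ''t'' [Const k, e]"
abbreviation tmp :: "nat \<Rightarrow> loc" where "tmp k \<equiv> Loc ''x'' [Const k]"

text \<open>
  The cells \<open>t [k, v]\<close> hold the triple of \<open>own\<close> for \<open>k < 3\<close> and the triples of \<open>tab\<close> for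
  \<open>3 \<le> k\<close>. A zero in \<open>child\<close> means that nothing is pending; position 0 is the root and never pends.
\<close>

definition init_step :: com where
  "init_step = Seq (Assign (Loc ''i'' []) (Minus pos_var (Const 1)))
    (Seq (Assign (Loc ''pos'' [vertex]) pos_var)
    (Seq (WCopy (T 0 pos_var) (Loc ''w'' [vertex]))
    (Seq (WCopy (T 1 pos_var) (Loc ''w'' [vertex]))
         (WZero (T 2 pos_var)))))"

text \<open>Row \<open>k\<close> is written first because two of the three minima reuse it.\<close>

definition extend :: "nat \<Rightarrow> com" where
  "extend k =
     Seq (WAdd (T k pos_var) (T 0 pos_var) (T (k + 2) child))
    (Seq (WAdd (tmp 0) (T 2 pos_var) (T (k + 1) child))
    (Seq (WMin (T (k + 2) pos_var) (tmp 0) (T k pos_var))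
    (Seq (WAdd (tmp 0) (T 1 pos_var) (T (k + 1) child))
    (Seq (WMin (tmp 0) (tmp 0) (T k pos_var))
    (Seq (WAdd (tmp 1) (T 2 pos_var) (T k child))
         (WMin (T (k + 1) pos_var) (tmp 0) (tmp 1)))))))"

definition copy :: com where
  "copy =
     Seq (WCopy (T 3 pos_var) (T 0 pos_var)) (Seq (WCopy (T 4 pos_var) (T 2 pos_var))
    (Seq (WCopy (T 5 pos_var) (T 2 pos_var)) (Seq (WCopy (T 6 pos_var) (T 0 pos_var))
    (Seq (WCopy (T 7 pos_var) (T 1 pos_var)) (Seq (WCopy (T 8 pos_var) (T 2 pos_var))
    (Seq (WCopy (T 9 pos_var) (T 0 pos_var)) (Seq (WCopy (T 10 pos_var) (T 0 pos_var))
         (WCopy (T 11 pos_var) (T 0 pos_var)))))))))"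

text \<open>All five sums are formed before a row of the father is overwritten, since they read its
  old entries.\<close>

definition close :: com where
  "close =
     Seq (WAdd (tmp 0) (T 0 father_pos) (T 5 pos_var))
    (Seq (WAdd (tmp 1) (T 1 father_pos) (T 7 pos_var))
    (Seq (WAdd (tmp 2) (T 2 father_pos) (T 6 pos_var))
    (Seq (WAdd (tmp 3) (T 2 father_pos) (T 10 pos_var))
    (Seq (WAdd (tmp 4) (T 2 father_pos) (T 7 pos_var))
    (Seq (WCopy (T 0 father_pos) (tmp 0))
    (Seq (WMin (T 2 father_pos) (tmp 0) (tmp 4))
    (Seq (WMin (tmp 1) (tmp 0) (tmp 1))
    (Seq (WMin (tmp 1) (tmp 1) (tmp 2))
         (WMin (T 1 father_pos) (tmp 1) (tmp 3))))))))))"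

definition build_tables :: com where
  "build_tables = If (Equal child (Const 0)) copy (Seq (extend 3) (Seq (extend 6) (extend 9)))"

text \<open>The guard is the right-hand side of \<open>pend_iff\<close>, with \<open>child\<close>
  standing for the existence of a pending child.\<close>

definition pass_on :: com where
  "pass_on = If (Conj (Neg (Equal first_vertex (Cell ''father'' [vertex])))
      (Neg (Conj (Equal child (Const 0)) (Equal (Cell ''adj'' [vertex, first_vertex]) (Const 0)))))
    (Assign (Loc ''child'' [father_pos]) pos_var)
    close"

definition main_step :: com where
  "main_step = Seq (Assign (Loc ''i'' []) (Minus pos_var (Const 1))) (Seq build_tables pass_on)"

definition program :: com where
  "program =
     Seq (Assign (Loc ''i'' []) (Cell ''n'' []))
    (Seq (While (Less (Const 0) pos_var) init_step)
    (Seq (Assign (Loc ''i'' []) (Cell ''n'' []))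
    (Seq (While (Less (Const 1) pos_var) main_step)
         (WCopy (Loc ''gamma'' []) (T 1 (Const 0))))))"

section \<open>Correctness and cost of the pieces of a step\<close>

lemma wp_extend:
  assumes "s ''child'' [s ''i'' []] \<noteq> s ''i'' []" and k: "3 \<le> k"
    and "\<And>p q r'. \<lbrakk>p = 4; q = 3; \<And>j u. u \<noteq> s ''i'' [] \<or> j < k \<or> k + 2 < j \<Longrightarrow> r' ''t'' [j, u] = r ''t'' [j, u];
      r' ''t'' [k, v] = r ''t'' [0, v] + r ''t'' [k + 2, y];
      r' ''t'' [k + 1, v] = min (min (r ''t'' [1, v] + r ''t'' [k + 1, y]) (r' ''t'' [k, v]))
         (r ''t'' [2, v] + r ''t'' [k, y]);
      r' ''t'' [k + 2, v] = min (r ''t'' [2, v] + r ''t'' [k + 1, y]) (r' ''t'' [k, v])\<rbrakk>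
      \<Longrightarrow> Q p q (s, r')"
    and "v = s ''i'' []" "y = s ''child'' [s ''i'' []]"
  shows "wp (extend k) Q (s, r)"
proof -
  \<comment> \<open>Otherwise the first write would destroy an entry of the child that is read
    later.\<close>
  have "v \<noteq> y" using assms(1,4,5) by auto
  then show ?thesis
    using k assms(4,5) by (simp add: extend_def wp_simps store_def load_def) (rule assms(3); auto)
qed

lemma wp_copy:
  assumes "v = s ''i'' []"
    and "\<And>p q r'. \<lbrakk>p = 0; q = 0; \<And>k u. u \<noteq> v \<Longrightarrow> r' ''t'' [k, u] = r ''t'' [k, u];
      let t = r ''t''; t' = r' ''t'' in t' [3, v] = t [0, v] \<and> t' [4, v] = t [2, v] \<and> t' [5, v] = t [2, v] \<and>
      t' [6, v] = t [0, v] \<and> t' [7, v] = t [1, v] \<and> t' [8, v] = t [2, v] \<and>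
      t' [9, v] = t [0, v] \<and> t' [10, v] = t [0, v] \<and> t' [11, v] = t [0, v]\<rbrakk> \<Longrightarrow> Q p q (s, r')"
  shows "wp copy Q (s, r)"
  by (simp add: copy_def wp_simps store_def load_def) (rule assms(2); auto simp: assms(1))

lemma wp_close:
  assumes "v = s ''i'' []" "f = s ''pos'' [s ''father'' [s ''order'' [s ''i'' []]]]"
    and "\<And>p q r'. \<lbrakk>p = 5; q = 4; \<And>k u. u \<noteq> f \<or> 3 \<le> k \<Longrightarrow> r' ''t'' [k, u] = r ''t'' [k, u];
      r' ''t'' [0, f] = r ''t'' [0, f] + r ''t'' [5, v];
      r' ''t'' [1, f] = min (min (min (r' ''t'' [0, f]) (r ''t'' [1, f] + r ''t'' [7, v]))
         (r ''t'' [2, f] + r ''t'' [6, v])) (r ''t'' [2, f] + r ''t'' [10, v]);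
      r' ''t'' [2, f] = min (r' ''t'' [0, f]) (r ''t'' [2, f] + r ''t'' [7, v])\<rbrakk>
      \<Longrightarrow> Q p q (s, r')"
  shows "wp close Q (s, r)"
  by (simp add: close_def wp_simps store_def load_def) (rule assms(3); auto simp: assms(1,2))

text \<open>The three extensions write disjoint blocks of rows at \<open>v\<close> and read only
  rows 0 to 2 at \<open>v\<close> and the rows of the child, so each of them sees the original
  values.\<close>

lemma (in dfs_cactus) wp_build_tables:
  assumes v: "v = s ''i'' []" "v < n" and ch: "pending (Suc v) (\<lambda>u. s ''child'' [u])"
    and t: "tables W (Suc v) (r ''t'')"
    and Q: "\<And>p q r'. \<lbrakk>p = (if s ''child'' [v] \<noteq> 0 then 12 else 0); q = (if s ''child'' [v] \<noteq> 0 then 9 else 0);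
      tab W (r' ''t'') v; \<And>k u. u \<noteq> v \<Longrightarrow> r' ''t'' [k, u] = r ''t'' [k, u]\<rbrakk> \<Longrightarrow> Q p q (s, r')"
  shows "wp build_tables Q (s, r)"
proof (cases "s ''child'' [v] = 0")
  case True
  have "wp copy Q (s, r)"
  proof (rule wp_copy[where s = s and v = v, OF v(1)])
    fix p q :: nat and r'
    assume "p = 0" "q = 0" and frame: "\<And>k u. u \<noteq> v \<Longrightarrow> r' ''t'' [k, u] = r ''t'' [k, u]"
      and "let t = r ''t''; t' = r' ''t'' in t' [3, v] = t [0, v] \<and> t' [4, v] = t [2, v] \<and> t' [5, v] = t [2, v] \<and>
      t' [6, v] = t [0, v] \<and> t' [7, v] = t [1, v] \<and> t' [8, v] = t [2, v] \<and>
      t' [9, v] = t [0, v] \<and> t' [10, v] = t [0, v] \<and> t' [11, v] = t [0, v]"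
    then show "Q p q (s, r')"
      using True by (intro Q tab_step[OF ch t v(2)]) (simp_all add: Let_def)
  qed
  then show ?thesis
    using True v by (simp add: build_tables_def wp_If)
next
  case False
  let ?y = "s ''child'' [v]"
  have y: "?y \<noteq> s ''i'' []"
    using pending_child(2)[OF ch v(2) False] v by auto
  then have y': "s ''child'' [s ''i'' []] \<noteq> s ''i'' []"
    using v by simp
  have "wp (Seq (extend 3) (Seq (extend 6) (extend 9))) Q (s, r)"
    unfolding wp_Seq
  proof (rule wp_extend[where s = s and v = v and y = ?y, OF y' _ _ v(1)])
    fix p1 q1 :: nat and r1
    assume 1: "p1 = 4" "q1 = 3"
      "\<And>j u. u \<noteq> s ''i'' [] \<or> j < 3 \<or> 3 + 2 < j \<Longrightarrow> r1 ''t'' [j, u] = r ''t'' [j, u]"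
      "r1 ''t'' [3, v] = r ''t'' [0, v] + r ''t'' [3 + 2, ?y]"
      "r1 ''t'' [3 + 1, v] = min (min (r ''t'' [1, v] + r ''t'' [3 + 1, ?y]) (r1 ''t'' [3, v]))
         (r ''t'' [2, v] + r ''t'' [3, ?y])"
      "r1 ''t'' [3 + 2, v] = min (r ''t'' [2, v] + r ''t'' [3 + 1, ?y]) (r1 ''t'' [3, v])"
    show "wp (extend 6) (\<lambda>p q. wp (extend 9) (\<lambda>p' q'. Q (p1 + (p + p')) (q1 + (q + q')))) (s, r1)"
    proof (rule wp_extend[where s = s and v = v and y = ?y, OF y' _ _ v(1)])
      fix p2 q2 :: nat and r2
      assume 2: "p2 = 4" "q2 = 3"
        "\<And>j u. u \<noteq> s ''i'' [] \<or> j < 6 \<or> 6 + 2 < j \<Longrightarrow> r2 ''t'' [j, u] = r1 ''t'' [j, u]"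
        "r2 ''t'' [6, v] = r1 ''t'' [0, v] + r1 ''t'' [6 + 2, ?y]"
        "r2 ''t'' [6 + 1, v] = min (min (r1 ''t'' [1, v] + r1 ''t'' [6 + 1, ?y]) (r2 ''t'' [6, v]))
           (r1 ''t'' [2, v] + r1 ''t'' [6, ?y])"
        "r2 ''t'' [6 + 2, v] = min (r1 ''t'' [2, v] + r1 ''t'' [6 + 1, ?y]) (r2 ''t'' [6, v])"
      show "wp (extend 9) (\<lambda>p' q'. Q (p1 + (p2 + p')) (q1 + (q2 + q'))) (s, r2)"
      proof (rule wp_extend[where s = s and v = v and y = ?y, OF y' _ _ v(1)])
        fix p3 q3 :: nat and r3
        assume 3: "p3 = 4" "q3 = 3"
          "\<And>j u. u \<noteq> s ''i'' [] \<or> j < 9 \<or> 9 + 2 < j \<Longrightarrow> r3 ''t'' [j, u] = r2 ''t'' [j, u]"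
          "r3 ''t'' [9, v] = r2 ''t'' [0, v] + r2 ''t'' [9 + 2, ?y]"
          "r3 ''t'' [9 + 1, v] = min (min (r2 ''t'' [1, v] + r2 ''t'' [9 + 1, ?y]) (r3 ''t'' [9, v]))
             (r2 ''t'' [2, v] + r2 ''t'' [9, ?y])"
          "r3 ''t'' [9 + 2, v] = min (r2 ''t'' [2, v] + r2 ''t'' [9 + 1, ?y]) (r3 ''t'' [9, v])"
        note frames = 1(3) 2(3) 3(3)
        have "r3 ''t'' [k, v] = r ''t'' [0, v] + r ''t'' [k + 2, ?y] \<and>
            r3 ''t'' [k + 1, v] = min (min (r ''t'' [1, v] + r ''t'' [k + 1, ?y]) (r3 ''t'' [k, v]))
              (r ''t'' [2, v] + r ''t'' [k, ?y]) \<and>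
            r3 ''t'' [k + 2, v] = min (r ''t'' [2, v] + r ''t'' [k + 1, ?y]) (r3 ''t'' [k, v])"
          if "k \<in> {3, 6, 9}" for k
          using that
        proof (elim insertE emptyE)
          assume k: "k = 3"
          show ?thesis
            unfolding k using 1(4-6) by (simp add: frames y)
        next
          assume k: "k = 6"
          show ?thesis
            unfolding k using 2(4-6) by (simp add: frames y)
        next
          assume k: "k = 9"
          show ?thesis
            unfolding k using 3(4-6) by (simp add: frames y)
        qed
        then have "tab W (r3 ''t'') v"
          using False by (intro tab_step[OF ch t v(2)]) simp_all
        then show "Q (p1 + (p2 + p3)) (q1 + (q2 + q3)) (s, r3)"
          using False 1(1,2) 2(1,2) 3(1,2) by (intro Q) (simp_all add: frames v(1))
      qed (simp_all add: v)
    qed (simp_all add: v)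
  qed (simp_all add: v)
  then show ?thesis
    using False v by (simp add: build_tables_def wp_If)
qed

section \<open>Loop invariants and the total cost\<close>

context cactus_input
begin

definition static :: "nat_memory \<Rightarrow> bool" where
  "static s \<longleftrightarrow> s ''n'' [] = length xs \<and>
     (\<forall>k<length xs. s ''order'' [k] = xs ! k \<and> s ''father'' [xs ! k] = xs ! par k \<and>
        s ''first'' [xs ! k] = xs ! cfi k \<and>
        (\<forall>j<length xs. s ''adj'' [xs ! k, xs ! j] = (if E k j then 1 else 0)))"

definition init_inv :: "(nat \<Rightarrow> real) \<Rightarrow> nat \<Rightarrow> nat \<Rightarrow> nat \<Rightarrow> state \<Rightarrow> bool" where
  "init_inv w i p q \<sigma> \<longleftrightarrow> (case \<sigma> of (s, r) \<Rightarrow> p = 0 \<and> q = 0 \<and> i \<le> length xs \<and>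
     static s \<and> s ''i'' [] = i \<and> (\<forall>k. s ''child'' [k] = 0) \<and>
     (\<forall>k<length xs. r ''w'' [xs ! k] = w (xs ! k)) \<and>
     (\<forall>k. i \<le> k \<and> k < length xs \<longrightarrow> s ''pos'' [xs ! k] = k \<and>
        r ''t'' [0, k] = w (xs ! k) \<and> r ''t'' [1, k] = w (xs ! k) \<and> r ''t'' [2, k] = 0))"

definition main_inv :: "(nat \<Rightarrow> real) \<Rightarrow> nat \<Rightarrow> nat \<Rightarrow> nat \<Rightarrow> state \<Rightarrow> bool" where
  "main_inv W i p q \<sigma> \<longleftrightarrow> (case \<sigma> of (s, r) \<Rightarrow> i \<le> length xs \<and>
     static s \<and> s ''i'' [] = i \<and> (\<forall>k<length xs. s ''pos'' [xs ! k] = k) \<and>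
     pending i (\<lambda>v. s ''child'' [v]) \<and> tables W i (r ''t'') \<and>
     cost_bound 12 i (\<lambda>v. s ''child'' [v]) p \<and> cost_bound 9 i (\<lambda>v. s ''child'' [v]) q)"

lemma init_step_correct:
  assumes "init_inv w (Suc i) p q \<sigma>"
  shows "wp init_step (\<lambda>p' q'. init_inv w i (p + p') (q + q')) \<sigma>"
proof -
  obtain s r where \<sigma>: "\<sigma> = (s, r)" by (cases \<sigma>)
  have inv: "p = 0" "q = 0" "i < length xs" "static s" "s ''i'' [] = Suc i" "\<forall>k. s ''child'' [k] = 0"
    "\<forall>k<length xs. r ''w'' [xs ! k] = w (xs ! k)"
    "\<And>k. i < k \<Longrightarrow> k < length xs \<Longrightarrow> s ''pos'' [xs ! k] = k \<and>
        r ''t'' [0, k] = w (xs ! k) \<and> r ''t'' [1, k] = w (xs ! k) \<and> r ''t'' [2, k] = 0"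
    using assms by (auto simp: \<sigma> init_inv_def Suc_le_eq)
  have order: "s ''order'' [i] = xs ! i"
    using inv by (simp add: static_def)
  have neq: "xs ! k = xs ! i \<longleftrightarrow> k = i" if "k < length xs" for k
    using that inv(3) distinct by (simp add: nth_eq_iff_index_eq)
  show ?thesis
    unfolding \<sigma>
    using inv order neq
    by (simp add: init_step_def wp_simps store_def load_def init_inv_def static_def Suc_le_eq le_less)
qed

lemma static_upd: "x \<in> {''i'', ''child''} \<Longrightarrow> static (s(x := f)) = static s"
  by (auto simp: static_def)

lemma main_step_correct:
  assumes "0 < v" "main_inv W (Suc v) p q \<sigma>"
  shows "wp main_step (\<lambda>p' q'. main_inv W v (p + p') (q + q')) \<sigma>"
proof -
  obtain s0 r0 where \<sigma>: "\<sigma> = (s0, r0)" by (cases \<sigma>)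
  \<comment> \<open>The counter is decremented first: \<open>s\<close> already holds
    \<open>v\<close>, while tables and costs are still those for \<open>Suc v\<close>.\<close>
  define s where "s = store s0 (''i'', []) v"
  define ch where "ch = (\<lambda>v. s ''child'' [v])"
  have v: "0 < v" "v < length xs" and i: "s ''i'' [] = v" and static: "static s" and
    pos: "\<And>k. k < length xs \<Longrightarrow> s ''pos'' [xs ! k] = k" and
    pend: "pending (Suc v) ch" and tables: "tables W (Suc v) (r0 ''t'')" and
    cost: "cost_bound 12 (Suc v) ch p" "cost_bound 9 (Suc v) ch q"
    using assms by (auto simp: \<sigma> main_inv_def s_def ch_def store_def static_upd)
  have i0: "s0 ''i'' [] = Suc v"
    using assms by (simp add: \<sigma> main_inv_def)
  have pv: "par v < v" "par v < length xs"
    using par_less[OF v] v by auto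
  have cv: "cfi v < length xs"
    using cf_nth v by blast
  have mem: "s ''order'' [v] = xs ! v" "s ''father'' [xs ! v] = xs ! par v"
    "s ''first'' [xs ! v] = xs ! cfi v" "s ''adj'' [xs ! v, xs ! cfi v] = (if E v (cfi v) then 1 else 0)"
    using static v cv by (auto simp: static_def)
  \<comment> \<open>Vertices in distinct list positions differ, so the comparison of vertices in the
    guard is the comparison of positions in \<open>pend_iff\<close>.\<close>
  have test: "bval (Conj (Neg (Equal first_vertex (Cell ''father'' [vertex])))
      (Neg (Conj (Equal child (Const 0)) (Equal (Cell ''adj'' [vertex, first_vertex]) (Const 0))))) s \<longleftrightarrow> pend v"
    using pend_iff[OF v] pending_child(1)[OF pend v(2)] distinct pv cv
    by (auto simp: i mem ch_def nth_eq_iff_index_eq)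
  have "wp build_tables (\<lambda>p1 q1. wp pass_on (\<lambda>p2 q2. main_inv W v (p + (p1 + p2)) (q + (q1 + q2)))) (s, r0)"
  proof (rule wp_build_tables[where s = s and v = v and r = r0, OF i[symmetric] v(2) pend[unfolded ch_def] tables])
    fix p1 q1 :: nat and r1
    assume "p1 = (if s ''child'' [v] \<noteq> 0 then 12 else 0)" "q1 = (if s ''child'' [v] \<noteq> 0 then 9 else 0)"
      and tab: "tab W (r1 ''t'') v" and frame: "\<And>k u. u \<noteq> v \<Longrightarrow> r1 ''t'' [k, u] = r0 ''t'' [k, u]"
    then have p1: "p1 \<le> (if ch v \<noteq> 0 then 12 else 0)" and q1: "q1 \<le> (if ch v \<noteq> 0 then 9 else 0)"
      by (simp_all add: ch_def)
    note c12 = cost_step[OF cost(1) v(2) p1] and c9 = cost_step[OF cost(2) v(2) q1]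
    show "wp pass_on (\<lambda>p2 q2. main_inv W v (p + (p1 + p2)) (q + (q1 + q2))) (s, r1)"
    proof (cases "pend v")
      case True
      define s' where "s' = store s (''child'', [par v]) v"
      have "(\<lambda>v. s' ''child'' [v]) = ch(par v := v)"
        by (auto simp: s'_def store_def ch_def)
      moreover have "static s'" "s' ''i'' [] = v" "s' ''pos'' = s ''pos''"
        using static i by (simp_all add: s'_def store_def static_upd)
      ultimately have "main_inv W v (p + p1) (q + q1) (s', r1)"
        using v pos pending_step(1)[OF pend v(2) True] tables_pend[OF tables True tab frame]
          c12(1)[of 0] c9(1)[of 0] by (simp add: main_inv_def)
      then show ?thesis
        using True test by (simp add: pass_on_def wp_simps i mem pos pv s'_def)
    next
      case False
      have "wp close (\<lambda>p2 q2. main_inv W v (p + (p1 + p2)) (q + (q1 + q2))) (s, r1)"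
      proof (rule wp_close[where s = s and v = v and f = "par v", OF i[symmetric]])
        show "par v = s ''pos'' [s ''father'' [s ''order'' [s ''i'' []]]]"
          by (simp add: i mem pos pv)
        fix p2 q2 :: nat and r2
        assume pq: "p2 = 5" "q2 = 4"
          and close: "r2 ''t'' [0, par v] = r1 ''t'' [0, par v] + r1 ''t'' [5, v]"
            "r2 ''t'' [1, par v] = min (min (min (r2 ''t'' [0, par v]) (r1 ''t'' [1, par v] + r1 ''t'' [7, v]))
               (r1 ''t'' [2, par v] + r1 ''t'' [6, v])) (r1 ''t'' [2, par v] + r1 ''t'' [10, v])"
            "r2 ''t'' [2, par v] = min (r2 ''t'' [0, par v]) (r1 ''t'' [2, par v] + r1 ''t'' [7, v])"
          and frame': "\<And>k u. u \<noteq> par v \<or> 3 \<le> k \<Longrightarrow> r2 ''t'' [k, u] = r1 ''t'' [k, u]"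
        have "tables W v (r2 ''t'')"
          by (rule tables_close[OF tables v False tab frame close frame'])
        then show "main_inv W v (p + (p1 + p2)) (q + (q1 + q2)) (s, r2)"
          using v static i pos pending_step(2)[OF pend v(2) False] c12(2)[of 5] c9(2)[of 4] pq
          by (simp add: main_inv_def ch_def add.assoc)
      qed
      then show ?thesis
        unfolding pass_on_def wp_If using False test by (simp only: fst_conv if_False)
    qed
  qed
  then show ?thesis
    by (simp add: main_step_def wp_simps \<sigma> i0 s_def add.assoc)
qed

lemma input_static: "static (input_nats K xs fa cf)"
  using fa_nth cf_nth nth_in length_xs by (auto simp: static_def input_nats_def E_def)

lemma program_correct:
  assumes w: "\<forall>v\<in>pverts K. 0 < w v"
  shows "wp program (\<lambda>p q \<tau>. result \<tau> = weighted_domination_number K w \<and>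
     p < 12 * length xs \<and> q < 9 * length xs) (input_state K w xs fa cf)"
proof -
  let ?n = "length xs" and ?s = "input_nats K xs fa cf" and ?r = "input_weights K w"
  let ?W = "w \<circ> (!) xs"
  define s1 where "s1 = store ?s (''i'', []) ?n"
  have n: "?s ''n'' [] = ?n"
    using input_static by (simp add: static_def)
  have "init_inv w ?n 0 0 (s1, ?r)"
    using input_static nth_in
    by (auto simp: init_inv_def s1_def store_def static_upd input_weights_def)
      (simp add: input_nats_def)
  then have "wp (While (Less (Const 0) pos_var) init_step) (\<lambda>p' q'. init_inv w 0 (0 + p') (0 + q')) (s1, ?r)"
  proof (intro wp_While_countdown[of 0 ?n "init_inv w"])
    fix i p q \<sigma> assume "init_inv w (Suc i) p q \<sigma>"
    moreover from this have "bval (Less (Const 0) pos_var) (fst \<sigma>)"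
      by (auto simp: init_inv_def)
    ultimately show "bval (Less (Const 0) pos_var) (fst \<sigma>) \<and>
        wp init_step (\<lambda>p' q'. init_inv w i (p + p') (q + q')) \<sigma>"
      using init_step_correct by blast
  qed (auto simp: init_inv_def)
  then have init: "wp (While (Less (Const 0) pos_var) init_step) (init_inv w 0) (s1, ?r)"
    by simp
  have main: "wp (While (Less (Const 1) pos_var) main_step) (main_inv ?W 1)
      (store s (''i'', []) ?n, r)" if inv: "init_inv w 0 p q (s, r)" for p q s r
  proof -
    have "tables ?W ?n (r ''t'')"
      using inv w nth_in by (intro tables_n) (auto simp: init_inv_def less_imp_le)
    moreover have "(\<lambda>v. s ''child'' [v]) = (\<lambda>_. 0)"
      using inv by (simp add: init_inv_def)
    ultimately have "main_inv ?W ?n 0 0 (store s (''i'', []) ?n, r)"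
      using inv pending_n by (simp add: main_inv_def init_inv_def store_def static_upd cost_bound_def)
    then have "wp (While (Less (Const 1) pos_var) main_step) (\<lambda>p' q'. main_inv ?W 1 (0 + p') (0 + q'))
      (store s (''i'', []) ?n, r)"
    proof (intro wp_While_countdown[of 1 ?n "main_inv ?W"])
      fix i p q \<sigma> assume "1 \<le> i" "main_inv ?W (Suc i) p q \<sigma>"
      moreover from this have "bval (Less (Const 1) pos_var) (fst \<sigma>)"
        by (auto simp: main_inv_def)
      ultimately show "bval (Less (Const 1) pos_var) (fst \<sigma>) \<and>
          wp main_step (\<lambda>p' q'. main_inv ?W i (p + p') (q + q')) \<sigma>"
        using main_step_correct[of i ?W p q \<sigma>] by simp
    qed (use n_pos in \<open>auto simp: main_inv_def Suc_le_eq\<close>)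
    then show ?thesis by simp
  qed
  \<comment> \<open>The loop stops at 1 because the root is absorbed by no father; the
    \<open>n - 1\<close> paid positions give the strict inequalities.\<close>
  have final: "result (s, store r (''gamma'', []) (r ''t'' [1, 0])) = weighted_domination_number K w \<and>
     p < 12 * ?n \<and> q < 9 * ?n" if "main_inv ?W 1 p q (s, r)" for p q s r
  proof -
    have "tables ?W 1 (r ''t'')" "p \<le> 12 * (?n - 1)" "q \<le> 9 * (?n - 1)"
      using that by (auto simp: main_inv_def cost_bound_def)
    moreover from this have "p < 12 * ?n" "q < 9 * ?n"
      using n_pos by linarith+
    ultimately show ?thesis
      using tables_1 weighted_domination_number_eq by (simp add: result_def store_def)
  qed
  have start: "wp (Assign (Loc ''i'' []) (Cell ''n'' [])) Q (s, r) \<longleftrightarrow> Q 0 0 (store s (''i'', []) ?n, r)"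
    if "s ''n'' [] = ?n" for Q s r
    using that by (simp add: wp_exec[OF exec.Assign])
  show ?thesis
    unfolding program_def input_state_def wp_Seq start[where s = ?s, OF n, folded s1_def]
  proof (rule wp_mono[OF init])
    fix p q \<sigma> assume inv: "init_inv w 0 p q \<sigma>"
    obtain s r where \<sigma>: "\<sigma> = (s, r)" by (cases \<sigma>)
    have n': "s ''n'' [] = ?n" and pq: "p = 0" "q = 0"
      using inv by (auto simp: \<sigma> init_inv_def static_def)
    show "wp (Assign (Loc ''i'' []) (Cell ''n'' [])) (\<lambda>p1 q1. wp (While (Less (Const 1) pos_var) main_step)
        (\<lambda>p2 q2. wp (WCopy (Loc ''gamma'' []) (T 1 (Const 0))) (\<lambda>p3 q3 \<tau>.
          result \<tau> = weighted_domination_number K w \<and>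
          0 + (p + (p1 + (p2 + p3))) < 12 * ?n \<and> 0 + (q + (q1 + (q2 + q3))) < 9 * ?n))) \<sigma>"
      unfolding \<sigma> start[where s = s, OF n']
    proof (rule wp_mono[OF main[OF inv[unfolded \<sigma>]]])
      fix p' q' \<sigma>' assume inv': "main_inv ?W 1 p' q' \<sigma>'"
      obtain s' r' where \<sigma>': "\<sigma>' = (s', r')" by (cases \<sigma>')
      show "wp (WCopy (Loc ''gamma'' []) (T 1 (Const 0))) (\<lambda>p3 q3 \<tau>.
          result \<tau> = weighted_domination_number K w \<and>
          0 + (p + (0 + (p' + p3))) < 12 * ?n \<and> 0 + (q + (0 + (q' + q3))) < 9 * ?n) \<sigma>'"
        using final[of p' q' s' r'] inv' pq unfolding \<sigma>'
        by (simp add: wp_exec[OF exec.WCopy] load_def)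
    qed
  qed
qed

end

theorem theorem1:
  shows "\<exists>P :: com. \<forall>(K :: nat pair_pre_digraph) (w :: nat \<Rightarrow> real) xs fa cf n b.
    cactus K \<longrightarrow> (\<forall>v\<in>pverts K. 0 < w v) \<longrightarrow>
    n = card (pverts K) \<longrightarrow> b = num_blocks K \<longrightarrow> b < n \<longrightarrow>
    dfs_data K xs fa cf \<longrightarrow>
    (\<exists>p q \<tau>. exec P (input_state K w xs fa cf) p q \<tau> \<and>
       result \<tau> = weighted_domination_number K w \<and>
       p < 12 * n + 5 * b \<and> q < 9 * n + 2 * b)"
proof (intro exI[of _ program] allI impI)
  fix K :: "nat pair_pre_digraph" and w :: "nat \<Rightarrow> real" and xs fa cf n b
  assume "cactus K" and w: "\<forall>v\<in>pverts K. 0 < w v" and n: "n = card (pverts K)"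
    and "dfs_data K xs fa cf"
  then interpret cactus_input K xs fa cf
    by unfold_locales
  show "\<exists>p q \<tau>. exec program (input_state K w xs fa cf) p q \<tau> \<and>
       result \<tau> = weighted_domination_number K w \<and> p < 12 * n + 5 * b \<and> q < 9 * n + 2 * b"
    \<comment> \<open>The bounds \<open>12 * n\<close> and \<open>9 * n\<close> come from
      \<open>program_correct\<close>; the multiples of \<open>b\<close> are added on the
      right.\<close>
    using program_correct[OF w] unfolding wp_def n length_xs[symmetric]
    by (meson trans_less_add1)
qed

end
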